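(* Let $G$ be a connected graph with three distinct vertices $v$, $u$, $w$, let $n\geq 1$ be an integer, and let ${}^{+}\mathcal{G}^{+}_n$ be the graph obtained from the (second kind of) fan-like graph $\mathcal{G}_n$ by adding the two end edges described in the context. Let $G^{+}$ be $G$ with an added edge joining $v$ and $w$, let ${}^{+}G$ be $G$ with an added edge joining $v$ and $u$, and let ${}^{+}G^{+}$ be $G$ with both added edges. Write $T(\cdot)=T(\cdot;x,y)$ for the Tutte polynomial and put \begin{align*} A&=\frac{x}{xy-x-y}\big((y-1)T(G)-T(G/\{v,u\})\big),\\ B&=\frac{1}{xy-x-y}\big((x-1)T(G/\{v,u\})-T(G)\big),\\ C&=\frac{x}{xy-x-y}\big((y-1)T(G^{+})-T(G^{+}/\{v,u\})\big),\\ D&=\frac{1}{xy-x-y}\big((x-1)T(G^{+}/\{v,u\})-T(G^{+})\big),\\ \lambda_{1,2}&=\frac{A+D\pm\sqrt{(A-D)^2+4BC}}{2}. \end{align*} Then $$T({}^{+}\mathcal{G}^{+}_n)=T({}^{+}G^{+})\frac{\lambda^n_1-\lambda^n_2}{\lambda_1-\lambda_2}+\big(C\,T({}^{+}G)-A\,T({}^{+}G^{+})\big)\frac{\lambda^{n-1}_1-\lambda^{n-1}_2}{\lambda_1-\lambda_2},$$ and equivalently \begin{align*} T({}^{+}\mathcal{G}^{+}_n)=&\big(C\,T({}^{+}G)-A\,T({}^{+}G^{+})\big)\sum_{j=0}^{\lfloor \frac{n-2}{2}\rfloor}\binom{n-j-2}{j}(A+D)^{n-2j-2}(BC-AD)^{j}\\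 &+T({}^{+}G^{+})\sum_{j=0}^{\lfloor \frac{n-1}{2}\rfloor}\binom{n-j-1}{j}(A+D)^{n-2j-1}(BC-AD)^{j}. \end{align*}
   Context: Graphs are finite; loops and multiple edges are allowed. The Tutte polynomial of a graph $G=(V,E)$ is $T(G;x,y)=\sum_{S\subseteq E}(x-1)^{r(E)-r(S)}(y-1)^{|S|-r(S)}$, where $r(S)=|V|-\omega(V,S)$ and $\omega(V,S)$ is the number of connected components of $(V,S)$. For $S\subseteq V$, $G/S$ denotes the graph obtained from $G$ by identifying all vertices of $S$ into one new vertex, with all edges preserved (edges inside $S$ become loops). Fan-like graph $\mathcal{G}_n$: let $H_1,\dots,H_n$ be disjoint copies of $G$. Identify the $n$ copies of $v$ into one vertex (again called $v$), and for each $i=1,\dots,n-1$ add an edge $e_i$ joining the copy of $w$ in $H_i$ to the copy of $u$ in $H_{i+1}$. The graph ${}^{+}\mathcal{G}_n$ is obtained from $\mathcal{G}_n$ by adding a new edge joining $v$ and the vertex $u$ of $H_1$; ${}^{+}\mathcal{G}^{+}_n$ is obtained from ${}^{+}\mathcal{G}_n$ by adding a new edge joining $v$ and the vertex $w$ of $H_n$. In particular ${}^{+}\mathcal{G}_1={}^{+}G$ and ${}^{+}\mathcal{G}^{+}_1={}^{+}G^{+}$. All added edges are new edges, even if parallel to existing ones. Identities are between elements of an algebraic closure of $\mathbb{Q}(x,y)$; empty sums are $0$. *)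

theory Defs
  imports
    "HOL-Library.Uprod"
    "HOL-Computational_Algebra.Computational_Algebra"
    "HOL-Algebra.Algebraic_Closure_Type"
begin

text \<open>
  Undirected multigraphs. Edges are abstract names carrying an unordered pair of end vertices, so
  that parallel edges and loops (edges with ends \<open>Upair a a\<close>) are allowed.
\<close>

record ('v, 'e) multigraph =
  verts :: "'v set"
  edges :: "'e set"
  ends :: "'e \<Rightarrow> 'v uprod"

definition finite_multigraph :: "('v, 'e) multigraph \<Rightarrow> bool" where
  "finite_multigraph G \<longleftrightarrow> finite (verts G) \<and> finite (edges G) \<and>
     (\<forall>e \<in> edges G. set_uprod (ends G e) \<subseteq> verts G)"

text \<open>
  \<open>reach G S\<close> is connectedness in the spanning subgraph \<open>(V, S)\<close>; its classes on \<open>V\<close>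
  are the connected components. The relation \<open>adjacency G S\<close> is symmetric
  since \<open>Upair a b = Upair b a\<close>.
\<close>

definition adjacency :: "('v, 'e) multigraph \<Rightarrow> 'e set \<Rightarrow> ('v \<times> 'v) set" where
  "adjacency G S = {(a, b). \<exists>e \<in> S. ends G e = Upair a b}"

definition reach :: "('v, 'e) multigraph \<Rightarrow> 'e set \<Rightarrow> ('v \<times> 'v) set" where
  "reach G S = (adjacency G S)\<^sup>* \<inter> verts G \<times> verts G"

definition num_components :: "('v, 'e) multigraph \<Rightarrow> 'e set \<Rightarrow> nat" where
  "num_components G S = card (verts G // reach G S)"

definition connected_multigraph :: "('v, 'e) multigraph \<Rightarrow> bool" where
  "connected_multigraph G \<longleftrightarrow>
     verts G \<noteq> {} \<and> (\<forall>a \<in> verts G. \<forall>b \<in> verts G. (a, b) \<in> reach G (edges G))"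

text \<open>
  On finite multigraphs none of the natural number subtractions in the next two definitions
  truncates: \<open>\<omega>(V,S) \<le> |V|\<close>, \<open>r(S) \<le> r(E)\<close> and \<open>r(S) \<le> |S|\<close>.
\<close>

definition graph_rank :: "('v, 'e) multigraph \<Rightarrow> 'e set \<Rightarrow> nat" where
  "graph_rank G S = card (verts G) - num_components G S"

definition tutte :: "('v, 'e) multigraph \<Rightarrow> 'a :: comm_ring_1 \<Rightarrow> 'a \<Rightarrow> 'a" where
  "tutte G x y = (\<Sum>S \<in> Pow (edges G).
     (x - 1) ^ (graph_rank G (edges G) - graph_rank G S) * (y - 1) ^ (card S - graph_rank G S))"

text \<open>
  \<open>identify S G\<close> is the graph \<open>G/S\<close>: the vertices in \<open>S\<close> are merged into the new vertex
  \<open>None\<close>, any other vertex \<open>a\<close> becomes \<open>Some a\<close>, and all edges are kept.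
\<close>

definition merge_map :: "'v set \<Rightarrow> 'v \<Rightarrow> 'v option" where
  "merge_map S a = (if a \<in> S then None else Some a)"

definition identify :: "'v set \<Rightarrow> ('v, 'e) multigraph \<Rightarrow> ('v option, 'e) multigraph" where
  "identify S G = \<lparr>verts = merge_map S ` verts G, edges = edges G,
     ends = (\<lambda>e. map_uprod (merge_map S) (ends G e))\<rparr>"

text \<open>The type \<open>'e + 'i\<close> makes the added edges new, even if parallel to existing ones.\<close>

definition add_edges ::
    "'i set \<Rightarrow> ('i \<Rightarrow> 'v uprod) \<Rightarrow> ('v, 'e) multigraph \<Rightarrow> ('v, 'e + 'i) multigraph" where
  "add_edges I f G = \<lparr>verts = verts G, edges = Inl ` edges G \<union> Inr ` I,
     ends = case_sum (ends G) f\<rparr>"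

definition add_edge :: "'v \<Rightarrow> 'v \<Rightarrow> ('v, 'e) multigraph \<Rightarrow> ('v, 'e + unit) multigraph" where
  "add_edge a b G = add_edges {()} (\<lambda>_. Upair a b) G"

definition copies :: "nat \<Rightarrow> ('v, 'e) multigraph \<Rightarrow> (nat \<times> 'v, nat \<times> 'e) multigraph" where
  "copies n G = \<lparr>verts = {1..n} \<times> verts G, edges = {1..n} \<times> edges G,
     ends = (\<lambda>(i, e). map_uprod (Pair i) (ends G e))\<rparr>"

text \<open>
  The fan-like graph. The common vertex \<open>v\<close> is \<open>None\<close>; the copy of a vertex \<open>a \<noteq> v\<close>
  in the \<open>i\<close>-th copy of \<open>G\<close> is \<open>Some (i, a)\<close>. \<open>fan_closed\<close> adds the two end edges, from \<open>v\<close> to the first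
  copy of \<open>u\<close> and from \<open>v\<close> to the last copy of \<open>w\<close>.
\<close>

definition fan :: "'v \<Rightarrow> 'v \<Rightarrow> 'v \<Rightarrow> nat \<Rightarrow> ('v, 'e) multigraph \<Rightarrow>
    ((nat \<times> 'v) option, nat \<times> 'e + nat) multigraph" where
  "fan v u w n G =
     add_edges {1..<n} (\<lambda>i. Upair (Some (i, w)) (Some (i + 1, u)))
       (identify ({1..n} \<times> {v}) (copies n G))"

definition fan_closed :: "'v \<Rightarrow> 'v \<Rightarrow> 'v \<Rightarrow> nat \<Rightarrow> ('v, 'e) multigraph \<Rightarrow>
    ((nat \<times> 'v) option, ((nat \<times> 'e + nat) + unit) + unit) multigraph" where
  "fan_closed v u w n G =
     add_edge None (Some (n, w)) (add_edge None (Some (1, u)) (fan v u w n G))"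

text \<open>
  An algebraic closure of \<open>\<rat>(x, y)\<close>, where \<open>\<rat>(x, y)\<close> is the fraction field of \<open>\<rat>[x][y]\<close>.
\<close>

type_synonym ratfun_closure = "rat poly poly fract alg_closure"

definition var_x :: ratfun_closure where
  "var_x = to_ac (to_fract [:[:0, 1:]:])"

definition var_y :: ratfun_closure where
  "var_y = to_ac (to_fract [:0, 1:])"

definition tutte_poly :: "('v, 'e) multigraph \<Rightarrow> ratfun_closure" where
  "tutte_poly G = tutte G var_x var_y"

end

theory Submission
  imports Defs
begin

text \<open>
  Fix two vertices \<open>a\<close>, \<open>b\<close> of a connected graph and split the sum that defines its Tutte polynomial
  according to whether an edge set \<open>S\<close> connects \<open>a\<close> with \<open>b\<close>. If it does not, then
  \<open>r(S) < r(E)\<close> and a factor \<open>x - 1\<close> can be taken out. Let \<open>c\<close> be the sum over the connecting sets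
  (\<open>connected_sum\<close>) and \<open>s\<close> the sum over the others without that factor (\<open>separated_sum\<close>). Then
  \<open>T(G) = c + (x - 1) s\<close>, the edge \<open>ab\<close> gives \<open>T(G + ab) = y c + x s\<close>, and identifying \<open>a\<close> with
  \<open>b\<close> gives \<open>T(G/{a,b}) = (y - 1) c + s\<close>. Solving the first and the last equation for \<open>c\<close> and \<open>s\<close>
  explains the four coefficients: \<open>A = x s\<close> and \<open>B = c\<close> for \<open>G\<close>, and \<open>C = x s\<close> and \<open>D = c\<close> for
  \<open>G\<^sup>+\<close>, always with respect to the pair \<open>v\<close>, \<open>u\<close>.

  Let \<open>M\<close> consist of two connected graphs \<open>L\<close> and \<open>K\<close> that share one vertex \<open>v\<close>, together with
  an edge from \<open>p\<close> in \<open>L\<close> to \<open>q\<close> in \<open>K\<close>. Ranks of edge sets in \<open>L\<close> and in \<open>K\<close> add up, and the edge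
  \<open>pq\<close> is redundant exactly if \<open>v\<close> is connected with \<open>p\<close> in \<open>L\<close> and with \<open>q\<close> in \<open>K\<close>. Hence
  \<open>T(M) = T(L + vp) c + x T(L) s\<close>, where \<open>c\<close> and \<open>s\<close> belong to \<open>K\<close> and the pair \<open>v\<close>, \<open>q\<close>
  (\<open>tutte_glue\<close>). The last copy of \<open>G\<close> in a fan is glued on in this way, so
  \<open>s\<^sub>n = T(\<^sup>+G\<^sub>n)\<close> and \<open>t\<^sub>n = T(\<^sup>+G\<^sub>n\<^sup>+)\<close> satisfy
  \<open>s\<^sub>n\<^sub>+\<^sub>1 = A s\<^sub>n + B t\<^sub>n\<close> and \<open>t\<^sub>n\<^sub>+\<^sub>1 = C s\<^sub>n + D t\<^sub>n\<close>. By Cayley-Hamilton \<open>t\<close> satisfies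
  the second-order recurrence with trace \<open>A + D\<close> and determinant \<open>AD - BC\<close>, whose solution is a
  combination of Lucas polynomials; these have both a binomial-sum form and a Binet form.

  The Binet form divides by \<open>\<lambda>\<^sub>1 - \<lambda>\<^sub>2 = \<delta>\<close>. Since the \<open>c\<close> and \<open>s\<close> are polynomials, \<open>\<delta>\<^sup>2\<close> can be
  evaluated at \<open>x = y = 2\<close>, where every term in \<open>c\<close> and \<open>s\<close> becomes \<open>1\<close>; there \<open>A\<close>, \<open>B\<close>, \<open>C\<close>,
  \<open>D\<close> are counts (up to a factor \<open>2\<close>) with \<open>BC > 0\<close>, so that \<open>(A - D)\<^sup>2 + 4 B C > 0\<close>. Thus
  \<open>\<delta> \<noteq> 0\<close>.
\<close>

section \<open>Rank and connectivity\<close>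

text \<open>
  Unlike \<open>reach\<close>, this relation is not cut down to the vertex set, so it is a plain reflexive
  transitive closure. Between vertices the two agree.
\<close>
abbreviation linked :: "('v, 'e) multigraph \<Rightarrow> 'e set \<Rightarrow> 'v \<Rightarrow> 'v \<Rightarrow> bool" where
  "linked G S a b \<equiv> (a, b) \<in> (adjacency G S)\<^sup>*"

lemma linked_sym: "linked G S a b \<Longrightarrow> linked G S b a"
proof -
  have "sym (adjacency G S)"
    by (auto simp: sym_def adjacency_def) (metis Upair_inject)
  then show "linked G S a b \<Longrightarrow> linked G S b a"
    by (metis sym_rtrancl symD)
qed

lemma linked_mono: "linked G S a b \<Longrightarrow> S \<subseteq> T \<Longrightarrow> linked G T a b"
  by (rule rtrancl_mono[THEN subsetD]) (auto simp: adjacency_def)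

lemma linked_edge: "e \<in> S \<Longrightarrow> ends G e = Upair a b \<Longrightarrow> linked G S a b"
  by (auto simp: adjacency_def)

lemma linked_insert:
  assumes "ends G e = Upair a b"
  shows "linked G (insert e S) p q \<longleftrightarrow>
    linked G S p q \<or> (linked G S p a \<and> linked G S b q) \<or> (linked G S p b \<and> linked G S a q)"
proof -
  have "adjacency G (insert e S) = insert (a, b) (insert (b, a) (adjacency G S))"
    using assms by (auto simp: adjacency_def)
  then show ?thesis
    by (auto simp: rtrancl_insert intro: rtrancl_trans)
qed

lemma equiv_reach: "equiv (verts G) (reach G S)"
  by (rule equivI) (auto simp: reach_def refl_on_def sym_def trans_def intro: linked_sym rtrancl_trans)

text \<open>
  An edge whose ends lie in different components merges exactly these two and raises the rank by
  one; any other edge changes nothing. Together with \<open>graph_rank_empty\<close> this determines the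
  rank, so that all later rank computations are inductions over edge sets which need only
  connectivity and never count components.
\<close>
lemma graph_rank_insert:
  assumes fin: "finite_multigraph G" and e: "e \<in> edges G" "ends G e = Upair a b"
  shows "graph_rank G (insert e S) = graph_rank G S + (if linked G S a b then 0 else 1)"
proof (cases "linked G S a b")
  case True
  then have "linked G (insert e S) p q \<longleftrightarrow> linked G S p q" for p q
    unfolding linked_insert[OF e(2)] by (meson linked_sym rtrancl_trans)
  then have "reach G (insert e S) = reach G S"
    by (auto simp: reach_def)
  with True show ?thesis
    by (simp add: graph_rank_def num_components_def)
next
  case False
  let ?V = "verts G" and ?r = "reach G S" and ?r' = "reach G (insert e S)"
  have finV: "finite ?V" and ab: "a \<in> ?V" "b \<in> ?V"
    using fin e by (force simp: finite_multigraph_def)+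
  let ?Ca = "?r `` {a}" and ?Cb = "?r `` {b}"
  have cls: "?r' `` {p} = (if p \<in> ?Ca \<union> ?Cb then ?Ca \<union> ?Cb else ?r `` {p})" if "p \<in> ?V" for p
    using that ab by (auto simp: reach_def linked_insert[OF e(2)]) (meson linked_sym rtrancl_trans)+
  have ne: "?Ca \<noteq> ?Cb"
    using False ab by (auto simp: eq_equiv_class_iff[OF equiv_reach] reach_def)
  have in_cls: "?r `` {p} \<in> {?Ca, ?Cb} \<longleftrightarrow> p \<in> ?Ca \<union> ?Cb" if "p \<in> ?V" for p
  proof -
    have "?r `` {p} = ?Ca \<longleftrightarrow> (a, p) \<in> ?r" "?r `` {p} = ?Cb \<longleftrightarrow> (b, p) \<in> ?r"
      using ab eq_equiv_class_iff[OF equiv_reach that, of a] eq_equiv_class_iff[OF equiv_reach that, of b]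
        by (simp_all add: reach_def) (metis linked_sym)+
    then show ?thesis by simp
  qed
  \<comment> \<open>the classes of \<open>a\<close> and \<open>b\<close> are replaced by their union\<close>
  have "?V // ?r' = insert (?Ca \<union> ?Cb) (?V // ?r - {?Ca, ?Cb})"
  proof (intro equalityI subsetI)
    fix Z assume "Z \<in> ?V // ?r'"
    then obtain p where p: "p \<in> ?V" "Z = ?r' `` {p}"
      by (auto elim: quotientE)
    then show "Z \<in> insert (?Ca \<union> ?Cb) (?V // ?r - {?Ca, ?Cb})"
      using cls[OF p(1)] in_cls[OF p(1)] quotientI[OF p(1), of ?r] by (auto split: if_splits)
  next
    fix Z assume Z: "Z \<in> insert (?Ca \<union> ?Cb) (?V // ?r - {?Ca, ?Cb})"
    have "a \<in> ?Ca" using ab by (auto simp: reach_def)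
    then have "?r' `` {a} = ?Ca \<union> ?Cb" using cls[OF ab(1)] by simp
    then have 1: "?Ca \<union> ?Cb \<in> ?V // ?r'" using quotientI[OF ab(1), of ?r'] by simp
    { assume "Z \<in> ?V // ?r" "Z \<notin> {?Ca, ?Cb}"
      then obtain p where p: "p \<in> ?V" "Z = ?r `` {p}"
        by (auto elim: quotientE)
      with \<open>Z \<notin> {?Ca, ?Cb}\<close> have "Z = ?r' `` {p}"
        using cls[OF p(1)] in_cls[OF p(1)] by simp
      then have "Z \<in> ?V // ?r'" using quotientI[OF p(1)] by simp }
    with 1 Z show "Z \<in> ?V // ?r'" by auto
  qed
  moreover have finq: "finite (?V // ?r)"
    using finV by (auto intro: finite_quotient simp: reach_def)
  moreover have "?Ca \<union> ?Cb \<notin> ?V // ?r - {?Ca, ?Cb}"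
  proof
    assume "?Ca \<union> ?Cb \<in> ?V // ?r - {?Ca, ?Cb}"
    moreover have "a \<in> ?Ca" using ab by (auto simp: reach_def)
    moreover have "?Ca \<in> ?V // ?r" using ab by (simp add: quotientI)
    ultimately show False
      using quotient_disj[OF equiv_reach, of "?Ca \<union> ?Cb" G S ?Ca] by auto
  qed
  moreover have sub: "{?Ca, ?Cb} \<subseteq> ?V // ?r"
    using ab by (auto simp: quotientI)
  ultimately have "card (?V // ?r') = Suc (card (?V // ?r) - 2)"
    using ne by (simp add: card_Diff_subset)
  moreover have "card {?Ca, ?Cb} \<le> card (?V // ?r)"
    using card_mono[OF finq sub] .
  moreover have "card (?V // ?r) \<le> card ?V"
    using finV by (simp add: quotient_def UNION_singleton_eq_range card_image_le)
  ultimately show ?thesis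
    using False ne by (simp add: graph_rank_def num_components_def)
qed

lemma graph_rank_empty: "graph_rank G {} = 0"
proof -
  have "reach G {} = Id_on (verts G)"
    by (auto simp: reach_def adjacency_def)
  then have "verts G // reach G {} = (\<lambda>a. {a}) ` verts G"
    by (auto simp: quotient_def)
  then show ?thesis
    by (simp add: graph_rank_def num_components_def card_image)
qed

lemma finite_multigraph_ends:
  assumes "finite_multigraph G" "e \<in> edges G"
  obtains a b where "ends G e = Upair a b" "a \<in> verts G" "b \<in> verts G"
  using assms by (cases "ends G e") (force simp: finite_multigraph_def)

lemma graph_rank_le_card:
  assumes "finite_multigraph G" "S \<subseteq> edges G"
  shows "graph_rank G S \<le> card S"
proof -
  have "finite S" using assms by (auto simp: finite_multigraph_def intro: finite_subset)
  then show ?thesis using assms(2)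
  proof (induction S)
    case (insert e S)
    then obtain a b where ab: "ends G e = Upair a b"
      using finite_multigraph_ends[OF assms(1)] by blast
    with insert show ?case by (simp add: graph_rank_insert[OF assms(1) _ ab])
  qed (simp add: graph_rank_empty)
qed

lemma graph_rank_mono:
  assumes "finite_multigraph G" "S \<subseteq> T" "T \<subseteq> edges G"
  shows "graph_rank G S \<le> graph_rank G T"
proof -
  have "finite (T - S)" using assms by (auto simp: finite_multigraph_def intro: finite_subset)
  moreover have "T - S \<subseteq> edges G" using assms by blast
  ultimately have "graph_rank G S \<le> graph_rank G ((T - S) \<union> S)"
  proof (induct rule: finite_induct)
    case (insert e U)
    obtain a b where ab: "ends G e = Upair a b"
      using finite_multigraph_ends[OF assms(1)] insert by blast
    with insert show ?case by (simp add: graph_rank_insert[OF assms(1) _ ab])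
  qed simp
  with assms(2) show ?thesis by (simp add: Un_absorb2)
qed

section \<open>Rank under contraction\<close>

lemma linked_image:
  assumes T: "\<And>t a b. t \<in> T \<Longrightarrow> ends H t = Upair a b \<Longrightarrow> f a = f b"
    and S: "\<And>e. e \<in> S \<Longrightarrow> ends G e = map_uprod f (ends H (g e))"
    and "linked H (T \<union> g ` S) a b"
  shows "linked G S (f a) (f b)"
  using assms(3)
proof (induction rule: rtrancl_induct)
  case (step b c)
  then obtain d where d: "d \<in> T \<union> g ` S" "ends H d = Upair b c"
    by (auto simp: adjacency_def)
  show ?case
  proof (cases "d \<in> T")
    case True
    then have "f b = f c" using T d(2) by blast
    with step.IH show ?thesis by simp
  next
    case False
    then obtain e where "e \<in> S" "d = g e" using d(1) by blast
    then have "(f b, f c) \<in> adjacency G S"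
      using S[of e] d(2) by (auto simp: adjacency_def)
    with step.IH show ?thesis by (rule rtrancl_into_rtrancl)
  qed
qed simp

text \<open>
  The map \<open>f\<close> exhibits \<open>(V(G), S)\<close> as what remains of \<open>T \<union> g(S)\<close>, up to isolated vertices, after
  contracting \<open>T\<close>: it is
  constant along the edges of \<open>T\<close>, and ends of edges in \<open>g(S)\<close> that it identifies are already
  linked by \<open>T\<close>. A path in \<open>G\<close> is lifted edge by edge, with the gaps between consecutive lifted
  edges bridged inside \<open>T\<close>. The set \<open>W\<close> restricts the condition on the fibres to the vertices
  where edges of \<open>g(S)\<close> end, since \<open>f\<close> may collapse everything else.
\<close>
lemma linked_contraction:
  assumes T: "\<And>t a b. t \<in> T \<Longrightarrow> ends H t = Upair a b \<Longrightarrow> f a = f b"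
    and S: "\<And>e. e \<in> S \<Longrightarrow> ends G e = map_uprod f (ends H (g e))"
    and W: "\<And>e. e \<in> S \<Longrightarrow> set_uprod (ends H (g e)) \<subseteq> W"
    and fibre: "\<And>a b. a \<in> W \<Longrightarrow> b \<in> W \<Longrightarrow> f a = f b \<Longrightarrow> linked H T a b"
    and ab: "a \<in> W" "b \<in> W"
  shows "linked H (T \<union> g ` S) a b \<longleftrightarrow> linked G S (f a) (f b)"
proof
  assume "linked G S (f a) (f b)"
  moreover have "linked H (T \<union> g ` S) a b" if "linked G S c d" "f a = c" "f b = d" "a \<in> W" "b \<in> W" for a b c d
    using that
  proof (induction arbitrary: b rule: rtrancl_induct)
    case base
    then have "linked H T a b" by (intro fibre) auto
    then show ?case by (rule linked_mono) simp
  next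
    case (step d d')
    then obtain e where e: "e \<in> S" "ends G e = Upair d d'"
      by (auto simp: adjacency_def)
    obtain p q where pq: "ends H (g e) = Upair p q" by (cases "ends H (g e)")
    have *: "\<exists>p q. ends H (g e) = Upair p q \<and> f p = d \<and> f q = d'"
    proof (cases "f p = d \<and> f q = d'")
      case False
      then have "f q = d \<and> f p = d'" using S[OF e(1)] e(2) pq by auto
      moreover have "Upair p q = Upair q p" by simp
      ultimately show ?thesis using pq by (intro exI[of _ q] exI[of _ p]) simp
    qed (use pq in blast)
    then obtain p q where pq: "ends H (g e) = Upair p q" "f p = d" "f q = d'" by blast
    have inW: "p \<in> W" "q \<in> W" using W[OF e(1)] pq(1) by auto
    have "linked H (T \<union> g ` S) a p" using step pq inW by blast
    moreover have "linked H (T \<union> g ` S) p q"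
      using e(1) pq(1) by (auto intro!: linked_edge)
    moreover have "linked H (T \<union> g ` S) q b"
      by (rule linked_mono[OF fibre]) (use inW step pq in auto)
    ultimately show ?case by (meson rtrancl_trans)
  qed
  ultimately show "linked H (T \<union> g ` S) a b" using ab by blast
next
  assume "linked H (T \<union> g ` S) a b"
  then show "linked G S (f a) (f b)"
    using linked_image[where T = T and H = H and f = f and S = S and G = G and g = g] T S by presburger
qed

text \<open>
  The matroid identity \<open>r(T \<union> S) = r(T) + r\<^bsub>/T\<^esub>(S)\<close>. With \<open>T = {}\<close> it shows that embeddings
  preserve rank, with \<open>T\<close> a new edge \<open>ab\<close> it computes the rank after identifying \<open>a\<close> with \<open>b\<close>, and
  with \<open>T\<close> one side of a graph glued at a vertex it shows that the ranks of the two sides add up.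
\<close>
lemma graph_rank_contraction:
  assumes fin: "finite_multigraph G" "finite_multigraph H"
    and sub: "S \<subseteq> edges G" "g ` S \<subseteq> edges H"
    and T: "\<And>t a b. t \<in> T \<Longrightarrow> ends H t = Upair a b \<Longrightarrow> f a = f b"
    and S: "\<And>e. e \<in> S \<Longrightarrow> ends G e = map_uprod f (ends H (g e))"
    and W: "\<And>e. e \<in> S \<Longrightarrow> set_uprod (ends H (g e)) \<subseteq> W"
    and fibre: "\<And>a b. a \<in> W \<Longrightarrow> b \<in> W \<Longrightarrow> f a = f b \<Longrightarrow> linked H T a b"
  shows "graph_rank H (T \<union> g ` S) = graph_rank H T + graph_rank G S"
proof -
  have "finite S" using fin sub by (auto simp: finite_multigraph_def intro: finite_subset)
  then show ?thesis using sub S W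
  proof (induction S)
    case (insert e S)
    obtain a b where ab: "ends H (g e) = Upair a b" by (cases "ends H (g e)")
    have ends: "ends G e = Upair (f a) (f b)" using insert.prems(3)[of e] ab by simp
    have "linked H (T \<union> g ` S) a b \<longleftrightarrow> linked G S (f a) (f b)"
    proof (rule linked_contraction[where W = W])
      show "a \<in> W" "b \<in> W" using insert.prems(4)[of e] ab by auto
    qed (use insert.prems(3,4) in \<open>auto intro: T fibre\<close>)
    moreover have "graph_rank H (T \<union> g ` S) = graph_rank H T + graph_rank G S"
      using insert by simp
    ultimately show ?case
      using insert.prems(1,2) graph_rank_insert[OF fin(2) _ ab, of "T \<union> g ` S"]
        graph_rank_insert[OF fin(1) _ ends, of S] by simp
  qed (simp add: graph_rank_empty)
qed

lemma
  assumes inj: "inj_on i (verts G)" and fin: "finite_multigraph G" "finite_multigraph H"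
    and sub: "S \<subseteq> edges G"
    and ends: "\<And>e. e \<in> S \<Longrightarrow> ends H (g e) = map_uprod i (ends G e)"
  shows linked_embedding: "a \<in> verts G \<Longrightarrow> b \<in> verts G \<Longrightarrow> linked H (g ` S) (i a) (i b) \<longleftrightarrow> linked G S a b"
    and graph_rank_embedding: "g ` S \<subseteq> edges H \<Longrightarrow> graph_rank H (g ` S) = graph_rank G S"
proof -
  let ?f = "inv_into (verts G) i"
  have S: "ends G e = map_uprod ?f (ends H (g e))"
    and W: "set_uprod (ends H (g e)) \<subseteq> i ` verts G" if "e \<in> S" for e
  proof -
    have "e \<in> edges G" using sub that by blast
    then obtain a b where "ends G e = Upair a b" "a \<in> verts G" "b \<in> verts G"
      by (rule finite_multigraph_ends[OF fin(1)])
    then show "ends G e = map_uprod ?f (ends H (g e))" "set_uprod (ends H (g e)) \<subseteq> i ` verts G"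
      using ends[OF that] by (simp_all add: inv_into_f_f[OF inj])
  qed
  have fibre: "linked H {} a b" if "a \<in> i ` verts G" "b \<in> i ` verts G" "?f a = ?f b" for a b
    using that by (auto simp: inv_into_f_f[OF inj])
  show "linked H (g ` S) (i a) (i b) \<longleftrightarrow> linked G S a b" if "a \<in> verts G" "b \<in> verts G"
    using linked_contraction[of "{}" H ?f S G g "i ` verts G" "i a" "i b"] S W fibre that inj
    by (simp add: inv_into_f_f)
  show "graph_rank H (g ` S) = graph_rank G S" if "g ` S \<subseteq> edges H"
    using graph_rank_contraction[of G H S g "{}" ?f "i ` verts G"] S W fibre that fin sub
    by (simp add: graph_rank_empty)
qed

section \<open>Adding an edge and identifying two vertices\<close>

lemma edges_add_edge: "edges (add_edge a b G) = insert (Inr ()) (Inl ` edges G)"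
  by (auto simp: add_edge_def add_edges_def)

lemma verts_add_edge [simp]: "verts (add_edge a b G) = verts G"
  by (simp add: add_edge_def add_edges_def)

lemma ends_add_edge [simp]:
  "ends (add_edge a b G) (Inl e) = ends G e" "ends (add_edge a b G) (Inr t) = Upair a b"
  by (simp_all add: add_edge_def add_edges_def)

lemma finite_multigraph_add_edge:
  "finite_multigraph G \<Longrightarrow> a \<in> verts G \<Longrightarrow> b \<in> verts G \<Longrightarrow> finite_multigraph (add_edge a b G)"
  by (auto simp: finite_multigraph_def edges_add_edge)

lemma linked_add_edge_Inl [simp]: "linked (add_edge a b G) (Inl ` S) p q \<longleftrightarrow> linked G S p q"
proof -
  have "adjacency (add_edge a b G) (Inl ` S) = adjacency G S"
    by (auto simp: adjacency_def)
  then show ?thesis by simp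
qed

lemma graph_rank_add_edge_Inl [simp]: "graph_rank (add_edge a b G) (Inl ` S) = graph_rank G S"
  by (simp add: graph_rank_def num_components_def reach_def adjacency_def)

lemma graph_rank_add_edge_Inr:
  assumes "finite_multigraph G" "a \<in> verts G" "b \<in> verts G"
  shows "graph_rank (add_edge a b G) (insert (Inr ()) (Inl ` S)) =
    graph_rank G S + (if linked G S a b then 0 else 1)"
  using graph_rank_insert[OF finite_multigraph_add_edge[OF assms], of "Inr ()" a b "Inl ` S"]
  by (simp add: edges_add_edge)

text \<open>Adding the edge \<open>ab\<close> raises the rank of \<open>S\<close> to at most that of \<open>T\<close> with \<open>ab\<close>, which is the rank of \<open>T\<close>.\<close>
lemma graph_rank_less:
  assumes fin: "finite_multigraph G" and ab: "a \<in> verts G" "b \<in> verts G"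
    and "S \<subseteq> T" "T \<subseteq> edges G" "linked G T a b" "\<not> linked G S a b"
  shows "graph_rank G S < graph_rank G T"
proof -
  have "graph_rank (add_edge a b G) (insert (Inr ()) (Inl ` S))
      \<le> graph_rank (add_edge a b G) (insert (Inr ()) (Inl ` T))"
    using assms by (intro graph_rank_mono finite_multigraph_add_edge) (auto simp: edges_add_edge)
  with assms show ?thesis by (simp add: graph_rank_add_edge_Inr)
qed

text \<open>Contracting the single new edge \<open>ab\<close> of \<open>G + ab\<close>, which has rank one.\<close>
lemma graph_rank_identify:
  assumes fin: "finite_multigraph G" and ab: "a \<in> verts G" "b \<in> verts G" "a \<noteq> b"
    and S: "S \<subseteq> edges G"
  shows "Suc (graph_rank (identify {a, b} G) S) = graph_rank G S + (if linked G S a b then 0 else 1)"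
proof -
  let ?H = "add_edge a b G" and ?K = "identify {a, b} G" and ?f = "merge_map {a, b}"
  have finK: "finite_multigraph ?K"
    unfolding finite_multigraph_def
  proof (intro conjI ballI)
    fix e assume "e \<in> edges ?K"
    then have "e \<in> edges G" by (simp add: identify_def)
    then obtain c d where "ends G e = Upair c d" "c \<in> verts G" "d \<in> verts G"
      by (rule finite_multigraph_ends[OF fin])
    then show "set_uprod (ends ?K e) \<subseteq> verts ?K" by (simp add: identify_def)
  next show "finite (verts ?K)" "finite (edges ?K)" using fin by (auto simp: identify_def finite_multigraph_def)
  qed
  have finH: "finite_multigraph ?H"
    by (rule finite_multigraph_add_edge[OF fin ab(1,2)])
  have "graph_rank ?H ({Inr ()} \<union> Inl ` S) = graph_rank ?H {Inr ()} + graph_rank ?K S"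
  proof (rule graph_rank_contraction[where f = ?f and W = UNIV])
    fix c d assume "?f c = ?f d"
    then have "c = d \<or> c \<in> {a, b} \<and> d \<in> {a, b}"
      by (auto simp: merge_map_def split: if_splits)
    moreover have new: "linked ?H {Inr ()} a b" by (rule linked_edge[of "Inr ()"]) simp_all
    ultimately show "linked ?H {Inr ()} c d" using new linked_sym[OF new] by (elim disjE) auto
  next
    fix t c d assume "t \<in> {Inr ()}" "ends ?H t = Upair c d"
    then show "?f c = ?f d" by (auto simp: merge_map_def)
  next
    show "S \<subseteq> edges ?K" "Inl ` S \<subseteq> edges ?H"
      using S by (auto simp: identify_def edges_add_edge)
  next
    fix e show "ends ?K e = map_uprod ?f (ends ?H (Inl e))" by (simp add: identify_def)
  qed (rule finK finH subset_UNIV)+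
  moreover have "graph_rank ?H {Inr ()} = 1"
    using graph_rank_add_edge_Inr[OF fin ab(1,2), of "{}"] ab(3)
    by (simp add: graph_rank_empty adjacency_def)
  ultimately show ?thesis
    using graph_rank_add_edge_Inr[OF fin ab(1,2), of S] by simp
qed

section \<open>The Tutte polynomial split by connectivity of two vertices\<close>

text \<open>
  In a graph that connects \<open>a\<close> with \<open>b\<close>, \<open>connected_sum\<close> is the part of \<open>T(G; x, y)\<close> over the edge
  sets that connect them too, and \<open>separated_sum\<close> is the remaining part divided by \<open>x - 1\<close>. The
  division is built into the exponents, so both are polynomials in \<open>x\<close> and \<open>y\<close> with integer
  coefficients and make sense in every commutative ring.
\<close>
definition connected_sum :: "('v, 'e) multigraph \<Rightarrow> 'v \<Rightarrow> 'v \<Rightarrow> 'a :: comm_ring_1 \<Rightarrow> 'a \<Rightarrow> 'a" where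
  "connected_sum G a b x y = (\<Sum>S \<in> Pow (edges G). if linked G S a b
     then (x - 1) ^ (graph_rank G (edges G) - graph_rank G S) * (y - 1) ^ (card S - graph_rank G S)
     else 0)"

definition separated_sum :: "('v, 'e) multigraph \<Rightarrow> 'v \<Rightarrow> 'v \<Rightarrow> 'a :: comm_ring_1 \<Rightarrow> 'a \<Rightarrow> 'a" where
  "separated_sum G a b x y = (\<Sum>S \<in> Pow (edges G). if linked G S a b then 0
     else (x - 1) ^ (graph_rank G (edges G) - Suc (graph_rank G S)) * (y - 1) ^ (card S - graph_rank G S))"

lemma sum_Pow_insert:
  assumes "finite A" "e \<notin> A"
  shows "(\<Sum>S \<in> Pow (insert e A). F S) = (\<Sum>S \<in> Pow A. F S + F (insert e S))"
proof -
  have "inj_on (insert e) (Pow A)" using assms(2) by (auto simp: inj_on_def)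
  moreover have "Pow A \<inter> insert e ` Pow A = {}" using assms(2) by auto
  ultimately show ?thesis
    using assms(1) by (simp add: Pow_insert sum.union_disjoint sum.reindex sum.distrib)
qed

lemma sum_Pow_image:
  assumes "inj_on g A"
  shows "(\<Sum>S \<in> Pow (g ` A). F S) = (\<Sum>S \<in> Pow A. F (g ` S))"
  using inj_on_image_Pow[OF assms] by (simp add: image_Pow_surj[OF refl, symmetric] sum.reindex)

lemma sum_Pow_Un:
  assumes "A \<inter> B = {}"
  shows "(\<Sum>S \<in> Pow (A \<union> B). F S) = (\<Sum>S \<in> Pow A. \<Sum>T \<in> Pow B. F (S \<union> T))"
proof -
  have "(\<Sum>S \<in> Pow (A \<union> B). F S) = (\<Sum>(S, T) \<in> Pow A \<times> Pow B. F (S \<union> T))"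
    by (rule sum.reindex_bij_witness[of _ "\<lambda>(S, T). S \<union> T" "\<lambda>S. (S \<inter> A, S \<inter> B)"])
      (use assms in \<open>auto simp: Int_absorb2 simp flip: Int_Un_distrib\<close>)
  then show ?thesis by (simp add: sum.cartesian_product)
qed

context
  fixes G :: "('v, 'e) multigraph" and a b :: 'v and x y :: "'a :: comm_ring_1"
  assumes fin: "finite_multigraph G" and ab: "a \<in> verts G" "b \<in> verts G"
    and conn: "linked G (edges G) a b"
begin

lemma tutte_eq_sums: "tutte G x y = connected_sum G a b x y + (x - 1) * separated_sum G a b x y"
proof -
  have "(x - 1) ^ (graph_rank G (edges G) - graph_rank G S) =
      (x - 1) * (x - 1) ^ (graph_rank G (edges G) - Suc (graph_rank G S))"
    if "S \<in> Pow (edges G)" "\<not> linked G S a b" for S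
    using graph_rank_less[OF fin ab _ _ conn, of S] that
    by (simp flip: power_Suc add: Suc_diff_Suc)
  then show ?thesis
    unfolding tutte_def connected_sum_def separated_sum_def sum_distrib_left sum.distrib[symmetric]
    by (intro sum.cong) auto
qed

text \<open>
  An edge set of \<open>G + ab\<close> is \<open>S\<close> or \<open>S\<close> with \<open>ab\<close>. If \<open>S\<close> connects \<open>a\<close> and \<open>b\<close>, the new edge raises
  only the nullity, which gives the factor \<open>1 + (y - 1)\<close>; otherwise it raises only the rank, which
  gives \<open>(x - 1) + 1\<close>.
\<close>
lemma tutte_add_edge: "tutte (add_edge a b G) x y = y * connected_sum G a b x y + x * separated_sum G a b x y"
proof -
  let ?H = "add_edge a b G" and ?r = "graph_rank G"
  have finE: "finite (edges G)" using fin by (simp add: finite_multigraph_def)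
  let ?t = "\<lambda>S. (x - 1) ^ (graph_rank ?H (edges ?H) - graph_rank ?H S) * (y - 1) ^ (card S - graph_rank ?H S)"
  have full: "graph_rank ?H (edges ?H) = ?r (edges G)"
    using conn by (simp add: edges_add_edge graph_rank_add_edge_Inr[OF fin ab])
  have "?t (Inl ` S) + ?t (insert (Inr ()) (Inl ` S)) =
      y * (if linked G S a b then (x - 1) ^ (?r (edges G) - ?r S) * (y - 1) ^ (card S - ?r S) else 0) +
      x * (if linked G S a b then 0 else (x - 1) ^ (?r (edges G) - Suc (?r S)) * (y - 1) ^ (card S - ?r S))"
    if S: "S \<in> Pow (edges G)" for S
  proof -
    have c: "card (Inl ` S :: ('e + unit) set) = card S" by (simp add: card_image)
    have "finite S" using S finE finite_subset by auto
    then have c': "card (insert (Inr ()) (Inl ` S) :: ('e + unit) set) = Suc (card S)"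
      by (subst card_insert_disjoint) (auto simp: c)
    have le: "?r S \<le> card S" "?r S \<le> ?r (edges G)"
      using graph_rank_le_card[OF fin] graph_rank_mono[OF fin] S by auto
    show ?thesis
    proof (cases "linked G S a b")
      case True
      then show ?thesis using le
        by (simp add: full c c' graph_rank_add_edge_Inr[OF fin ab] Suc_diff_le algebra_simps)
    next
      case False
      then have "?r S < ?r (edges G)" using graph_rank_less[OF fin ab _ _ conn] S by auto
      then obtain k where "?r (edges G) = Suc (?r S + k)" using less_imp_Suc_add by blast
      with False show ?thesis
        by (simp add: full c c' graph_rank_add_edge_Inr[OF fin ab] algebra_simps)
    qed
  qed
  moreover have "tutte ?H x y = (\<Sum>S \<in> Pow (edges G). ?t (Inl ` S) + ?t (insert (Inr ()) (Inl ` S)))"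
    unfolding tutte_def using finE
    by (subst edges_add_edge, subst sum_Pow_insert) (auto simp: sum_Pow_image)
  ultimately show ?thesis
    by (simp add: connected_sum_def separated_sum_def sum_distrib_left sum.distrib)
qed

text \<open>
  Identifying \<open>a\<close> with \<open>b\<close> lowers \<open>r(E)\<close> by one. If \<open>S\<close> connects \<open>a\<close> and \<open>b\<close>, its rank drops as
  well and its nullity grows by one; otherwise its rank stays the same.
\<close>
lemma tutte_identify:
  assumes "a \<noteq> b"
  shows "tutte (identify {a, b} G) x y = (y - 1) * connected_sum G a b x y + separated_sum G a b x y"
proof -
  let ?H = "identify {a, b} G" and ?r = "graph_rank G"
  have edges: "edges ?H = edges G" by (simp add: identify_def)
  have full: "Suc (graph_rank ?H (edges ?H)) = ?r (edges G)"
    using graph_rank_identify[OF fin ab assms, of "edges G"] conn by (simp add: edges)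
  have "(x - 1) ^ (graph_rank ?H (edges ?H) - graph_rank ?H S) * (y - 1) ^ (card S - graph_rank ?H S) =
      (y - 1) * (if linked G S a b then (x - 1) ^ (?r (edges G) - ?r S) * (y - 1) ^ (card S - ?r S) else 0) +
      (if linked G S a b then 0 else (x - 1) ^ (?r (edges G) - Suc (?r S)) * (y - 1) ^ (card S - ?r S))"
    if S: "S \<in> Pow (edges G)" for S
  proof -
    have le: "?r S \<le> card S"
      using graph_rank_le_card[OF fin] S by auto
    show ?thesis
    proof (cases "linked G S a b")
      case True
      then have r: "?r S = Suc (graph_rank ?H S)"
        using graph_rank_identify[OF fin ab assms, of S] S by simp
      with le obtain k where "card S = Suc (graph_rank ?H S + k)"
        by (metis add_Suc le_Suc_ex)
      with True r show ?thesis by (simp flip: full)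
    next
      case False
      then have r: "?r S = graph_rank ?H S"
        using graph_rank_identify[OF fin ab assms, of S] S by simp
      with False show ?thesis by (simp flip: full)
    qed
  qed
  then show ?thesis
    unfolding tutte_def connected_sum_def separated_sum_def sum_distrib_left sum.distrib[symmetric]
    by (intro sum.cong) (auto simp: edges)
qed

end

lemma tutte_iso:
  assumes inj: "inj_on i (verts G)" and fin: "finite_multigraph G" "finite_multigraph H"
    and g: "bij_betw g (edges G) (edges H)"
    and ends: "\<And>e. e \<in> edges G \<Longrightarrow> ends H (g e) = map_uprod i (ends G e)"
  shows "tutte H x y = tutte G x y"
proof -
  have img: "g ` edges G = edges H" and injg: "inj_on g (edges G)"
    using g by (auto simp: bij_betw_def)
  have r: "graph_rank H (g ` S) = graph_rank G S" if "S \<subseteq> edges G" for S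
    by (rule graph_rank_embedding[OF inj fin that]) (use that ends img in auto)
  have c: "card (g ` S) = card S" if "S \<subseteq> edges G" for S
    by (rule card_image) (rule inj_on_subset[OF injg that])
  show ?thesis
    unfolding tutte_def img[symmetric] sum_Pow_image[OF injg]
    by (intro sum.cong) (simp_all add: r c)
qed

text \<open>
  \<open>M\<close> consists of the images of \<open>L\<close> under \<open>i\<close> and of \<open>K\<close> under \<open>j\<close>, which meet in the vertex
  \<open>i v = j v'\<close>, and of the edge \<open>e\<close> from \<open>i p\<close> to \<open>j q\<close>. Pair the sets \<open>A \<union> B\<close> with and without \<open>e\<close>, for
  \<open>A\<close> from \<open>L\<close> and \<open>B\<close> from \<open>K\<close>. If \<open>A\<close> links \<open>v\<close> with \<open>p\<close> and \<open>B\<close> links \<open>v'\<close> with \<open>q\<close>, the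
  pair contributes the factor \<open>1 + (y - 1) = y\<close>, otherwise \<open>(x - 1) + 1 = x\<close>. The total is
  \<open>y c\<^sub>L c\<^sub>K + x (s\<^sub>L c\<^sub>K + c\<^sub>L s\<^sub>K + (x - 1) s\<^sub>L s\<^sub>K)\<close>, and grouping it by \<open>c\<^sub>K\<close> and \<open>s\<^sub>K\<close>
  produces \<open>T(L + vp)\<close> and \<open>T(L)\<close>.
\<close>
lemma tutte_glue:
  fixes x y :: "'a :: comm_ring_1"
  assumes fin: "finite_multigraph M" "finite_multigraph L" "finite_multigraph K"
    and vL: "v \<in> verts L" "p \<in> verts L" and vK: "v' \<in> verts K" "q \<in> verts K"
    and inj: "inj_on i (verts L)" "inj_on j (verts K)"
    and meet: "i ` verts L \<inter> j ` verts K \<subseteq> {i v}" "i v = j v'"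
    and injE: "inj_on g (edges L)" "inj_on h (edges K)" "g ` edges L \<inter> h ` edges K = {}"
    and edges: "edges M = insert e (g ` edges L \<union> h ` edges K)" "e \<notin> g ` edges L \<union> h ` edges K"
    and endsL: "\<And>d. d \<in> edges L \<Longrightarrow> ends M (g d) = map_uprod i (ends L d)"
    and endsK: "\<And>d. d \<in> edges K \<Longrightarrow> ends M (h d) = map_uprod j (ends K d)"
    and endse: "ends M e = Upair (i p) (j q)"
    and conn: "linked L (edges L) v p" "linked K (edges K) v' q"
  shows "tutte M x y = tutte (add_edge v p L) x y * connected_sum K v' q x y
    + x * (tutte L x y * separated_sum K v' q x y)"
proof -
  \<comment> \<open>\<open>\<phi>\<close> collapses the \<open>L\<close>-side of \<open>M\<close> to \<open>v'\<close> and inverts \<open>j\<close> on the \<open>K\<close>-side; \<open>\<psi>\<close> does the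
    same with the sides exchanged\<close>
  define \<phi> where "\<phi> b = (if b \<in> j ` verts K then inv_into (verts K) j b else v')" for b
  define \<psi> where "\<psi> b = (if b \<in> i ` verts L then inv_into (verts L) i b else v)" for b
  have \<phi>j: "\<phi> (j b) = b" if "b \<in> verts K" for b
    using that inj(2) by (simp add: \<phi>_def)
  have \<phi>i: "\<phi> (i b) = v'" if "b \<in> verts L" for b
  proof (cases "i b \<in> j ` verts K")
    case True
    then have "i b = j v'" using that meet by auto
    then show ?thesis using \<phi>j[OF vK(1)] by simp
  qed (simp add: \<phi>_def)
  have \<psi>i: "\<psi> (i b) = b" if "b \<in> verts L" for b
    using that inj(1) by (simp add: \<psi>_def)
  have \<psi>j: "\<psi> (j b) = v" if "b \<in> verts K" for b
  proof (cases "j b \<in> i ` verts L")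
    case True
    then have "j b = i v" using that meet by auto
    then show ?thesis using \<psi>i[OF vL(1)] by simp
  qed (simp add: \<psi>_def)
  have endL: "\<exists>c d. ends L t = Upair c d \<and> ends M (g t) = Upair (i c) (i d) \<and> c \<in> verts L \<and> d \<in> verts L"
    if t: "t \<in> edges L" for t
  proof -
    obtain c d where cd: "ends L t = Upair c d" "c \<in> verts L" "d \<in> verts L"
      using t by (rule finite_multigraph_ends[OF fin(2)])
    then show ?thesis using endsL[OF t] by (intro exI[of _ c] exI[of _ d]) simp
  qed
  have endK: "\<exists>c d. ends K t = Upair c d \<and> ends M (h t) = Upair (j c) (j d) \<and> c \<in> verts K \<and> d \<in> verts K"
    if t: "t \<in> edges K" for t
  proof -
    obtain c d where cd: "ends K t = Upair c d" "c \<in> verts K" "d \<in> verts K"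
      using t by (rule finite_multigraph_ends[OF fin(3)])
    then show ?thesis using endsK[OF t] by (intro exI[of _ c] exI[of _ d]) simp
  qed
  let ?rL = "graph_rank L" and ?rK = "graph_rank K" and ?rM = "graph_rank M"
  have rank: "?rM (g ` A \<union> h ` B) = ?rL A + ?rK B" if AB: "A \<subseteq> edges L" "B \<subseteq> edges K" for A B
  proof -
    have "?rM (g ` A \<union> h ` B) = ?rM (g ` A) + ?rK B"
    proof (rule graph_rank_contraction[where f = \<phi> and W = "j ` verts K"])
      show "finite_multigraph K" "finite_multigraph M" "B \<subseteq> edges K" "h ` B \<subseteq> edges M"
        using fin that edges(1) by auto
    next
      fix t c d assume t: "t \<in> g ` A" "ends M t = Upair c d"
      then obtain s where "s \<in> edges L" "t = g s" using AB t(1) by blast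
      then show "\<phi> c = \<phi> d" using endL[of s] t(2) by (auto simp: \<phi>i)
    next
      fix t assume "t \<in> B"
      then have "t \<in> edges K" using that by auto
      then show "ends K t = map_uprod \<phi> (ends M (h t))" "set_uprod (ends M (h t)) \<subseteq> j ` verts K"
        using endK[of t] by (auto simp: \<phi>j)
    next
      fix c d assume "c \<in> j ` verts K" "d \<in> j ` verts K" "\<phi> c = \<phi> d"
      then show "linked M (g ` A) c d" by (auto simp: \<phi>j)
    qed
    also have "?rM (g ` A) = ?rL A"
      by (rule graph_rank_embedding[OF inj(1) fin(2,1) that(1)]) (use that endsL edges in auto)
    finally show ?thesis .
  qed
  have bridge: "linked M (g ` A \<union> h ` B) (i p) (j q) \<longleftrightarrow> linked L A v p \<and> linked K B v' q"
    if AB: "A \<subseteq> edges L" "B \<subseteq> edges K" for A B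
  proof
    assume l: "linked M (g ` A \<union> h ` B) (i p) (j q)"
    have "linked K B (\<phi> (i p)) (\<phi> (j q))"
    proof (rule linked_image[OF _ _ l])
      fix t c d assume t: "t \<in> g ` A" "ends M t = Upair c d"
      then obtain s where "s \<in> edges L" "t = g s" using AB t(1) by blast
      then show "\<phi> c = \<phi> d" using endL[of s] t(2) by (auto simp: \<phi>i)
    next
      fix t assume "t \<in> B"
      then have "t \<in> edges K" using AB by auto
      then show "ends K t = map_uprod \<phi> (ends M (h t))"
        using endK[of t] by (auto simp: \<phi>j)
    qed
    moreover have "linked M (h ` B \<union> g ` A) (i p) (j q)" using l by (simp add: Un_commute)
    then have "linked L A (\<psi> (i p)) (\<psi> (j q))"
    proof (rule linked_image[rotated 2])
      fix t c d assume t: "t \<in> h ` B" "ends M t = Upair c d"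
      then obtain s where "s \<in> edges K" "t = h s" using AB t(1) by blast
      then show "\<psi> c = \<psi> d" using endK[of s] t(2) by (auto simp: \<psi>j)
    next
      fix t assume "t \<in> A"
      then have "t \<in> edges L" using AB by auto
      then show "ends L t = map_uprod \<psi> (ends M (g t))"
        using endL[of t] by (auto simp: \<psi>i)
    qed
    ultimately show "linked L A v p \<and> linked K B v' q"
      using linked_sym[of p v L A] by (simp add: \<phi>i \<phi>j \<psi>i \<psi>j vL vK)
  next
    assume l: "linked L A v p \<and> linked K B v' q"
    have "linked M (g ` A) (i p) (i v)"
      using linked_embedding[OF inj(1) fin(2,1) AB(1), where g = g and a = p and b = v] l endsL AB(1) vL linked_sym[of v p L A]
      by auto
    then have 1: "linked M (g ` A \<union> h ` B) (i p) (i v)" by (rule linked_mono) auto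
    have "linked M (h ` B) (j v') (j q)"
      using linked_embedding[OF inj(2) fin(3,1) AB(2), where g = h and a = v' and b = q] l endsK AB(2) vK by auto
    then have "linked M (g ` A \<union> h ` B) (i v) (j q)" unfolding meet(2) by (rule linked_mono) auto
    with 1 show "linked M (g ` A \<union> h ` B) (i p) (j q)" by (rule rtrancl_trans)
  qed
  let ?EL = "edges L" and ?EK = "edges K"
  have finE: "finite ?EL" "finite ?EK" using fin by (auto simp: finite_multigraph_def)
  have eM: "e \<in> edges M" using edges by simp
  have rank_e: "?rM (insert e (g ` A \<union> h ` B)) = ?rL A + ?rK B +
      (if linked L A v p \<and> linked K B v' q then 0 else 1)" if "A \<subseteq> ?EL" "B \<subseteq> ?EK" for A B
    using graph_rank_insert[OF fin(1) eM endse, of "g ` A \<union> h ` B"] rank[OF that] bridge[OF that] by simp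
  have full: "?rM (edges M) = ?rL ?EL + ?rK ?EK"
    using rank_e[of ?EL ?EK] conn by (simp add: edges(1))
  let ?t = "\<lambda>S. (x - 1) ^ (?rM (edges M) - ?rM S) * (y - 1) ^ (card S - ?rM S)"
  let ?cL = "\<lambda>S. if linked L S v p then (x - 1) ^ (?rL ?EL - ?rL S) * (y - 1) ^ (card S - ?rL S) else 0"
  let ?sL = "\<lambda>S. if linked L S v p then 0 else (x - 1) ^ (?rL ?EL - Suc (?rL S)) * (y - 1) ^ (card S - ?rL S)"
  let ?cK = "\<lambda>S. if linked K S v' q then (x - 1) ^ (?rK ?EK - ?rK S) * (y - 1) ^ (card S - ?rK S) else 0"
  let ?sK = "\<lambda>S. if linked K S v' q then 0 else (x - 1) ^ (?rK ?EK - Suc (?rK S)) * (y - 1) ^ (card S - ?rK S)"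
  have summand: "?t (g ` A \<union> h ` B) + ?t (insert e (g ` A \<union> h ` B)) =
      (y * ?cL A + x * ?sL A) * ?cK B + x * ((?cL A + (x - 1) * ?sL A) * ?sK B)"
    if AB: "A \<in> Pow ?EL" "B \<in> Pow ?EK" for A B
  proof -
    have AB': "A \<subseteq> ?EL" "B \<subseteq> ?EK" using AB by auto
    have finAB: "finite A" "finite B" using AB' finE finite_subset by auto
    have "card (g ` A \<union> h ` B) = card (g ` A) + card (h ` B)"
      by (rule card_Un_disjoint) (use finAB AB' injE(3) in auto)
    also have "\<dots> = card A + card B"
      using inj_on_subset[OF injE(1) AB'(1)] inj_on_subset[OF injE(2) AB'(2)] by (simp add: card_image)
    finally have c: "card (g ` A \<union> h ` B) = card A + card B" .
    have c': "card (insert e (g ` A \<union> h ` B)) = Suc (card A + card B)"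
      using finAB edges(2) AB' c by (subst card_insert_disjoint) auto
    \<comment> \<open>Writing the larger numbers as sums removes all natural number subtractions from the exponents.\<close>
    obtain l where l: "card A = ?rL A + l"
      using graph_rank_le_card[OF fin(2) AB'(1)] le_Suc_ex by blast
    obtain k where k: "card B = ?rK B + k"
      using graph_rank_le_card[OF fin(3) AB'(2)] le_Suc_ex by blast
    obtain l' where l': "?rL ?EL = (if linked L A v p then ?rL A + l' else Suc (?rL A + l'))"
    proof (cases "linked L A v p")
      case True
      then show ?thesis using graph_rank_mono[OF fin(2) AB'(1)] le_Suc_ex that by force
    next
      case False
      then show ?thesis
        using graph_rank_less[OF fin(2) vL AB'(1) order_refl conn(1)] less_imp_Suc_add that by force
    qed
    obtain k' where k': "?rK ?EK = (if linked K B v' q then ?rK B + k' else Suc (?rK B + k'))"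
    proof (cases "linked K B v' q")
      case True
      then show ?thesis using graph_rank_mono[OF fin(3) AB'(2)] le_Suc_ex that by force
    next
      case False
      then show ?thesis
        using graph_rank_less[OF fin(3) vK AB'(2) order_refl conn(2)] less_imp_Suc_add that by force
    qed
    have r: "?rM (g ` A \<union> h ` B) = ?rL A + ?rK B" using rank[OF AB'] .
    show ?thesis
      unfolding full r rank_e[OF AB'] c c'
      by (cases "linked L A v p"; cases "linked K B v' q")
        (simp_all add: l k l' k' power_add algebra_simps)
  qed
  have bilinear: "(\<Sum>A \<in> Pow ?EL. \<Sum>B \<in> Pow ?EK. F A * F' B + x * (F'' A * F''' B)) =
      sum F (Pow ?EL) * sum F' (Pow ?EK) + x * (sum F'' (Pow ?EL) * sum F''' (Pow ?EK))"
    for F F' F'' F''' unfolding sum_product sum.distrib by (simp add: sum_distrib_left)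
  have "tutte M x y = (\<Sum>A \<in> Pow ?EL. \<Sum>B \<in> Pow ?EK. ?t (g ` A \<union> h ` B) + ?t (insert e (g ` A \<union> h ` B)))"
    unfolding tutte_def
    by (subst edges(1), subst sum_Pow_insert)
      (use finE edges(2) injE in \<open>auto simp: sum_Pow_Un sum_Pow_image\<close>)
  also have "\<dots> = (\<Sum>A \<in> Pow ?EL. \<Sum>B \<in> Pow ?EK.
      (y * ?cL A + x * ?sL A) * ?cK B + x * ((?cL A + (x - 1) * ?sL A) * ?sK B))"
    by (intro sum.cong refl summand)
  also have "\<dots> = (\<Sum>A \<in> Pow ?EL. y * ?cL A + x * ?sL A) * (\<Sum>B \<in> Pow ?EK. ?cK B)
      + x * ((\<Sum>A \<in> Pow ?EL. ?cL A + (x - 1) * ?sL A) * (\<Sum>B \<in> Pow ?EK. ?sK B))"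
    by (rule bilinear)
  also have "\<dots> = (y * connected_sum L v p x y + x * separated_sum L v p x y) * connected_sum K v' q x y
      + x * ((connected_sum L v p x y + (x - 1) * separated_sum L v p x y) * separated_sum K v' q x y)"
    unfolding connected_sum_def separated_sum_def sum_distrib_left sum.distrib ..
  finally show ?thesis
    by (simp add: tutte_add_edge[OF fin(2) vL conn(1)] tutte_eq_sums[OF fin(2) vL conn(1)])
qed

section \<open>Fan-like graphs\<close>

definition fan_vertex :: "'v \<Rightarrow> nat \<Rightarrow> 'v \<Rightarrow> (nat \<times> 'v) option" where
  "fan_vertex v i a = (if a = v then None else Some (i, a))"

text \<open>The graph \<open>\<^sup>+G\<^sub>n\<close>, in which only the end edge at the first copy is present.\<close>
definition fan_left_closed :: "'v \<Rightarrow> 'v \<Rightarrow> 'v \<Rightarrow> nat \<Rightarrow> ('v, 'e) multigraph \<Rightarrow>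
    ((nat \<times> 'v) option, (nat \<times> 'e + nat) + unit) multigraph" where
  "fan_left_closed v u w n G = add_edge None (Some (1, u)) (fan v u w n G)"

lemma fan_closed_eq: "fan_closed v u w n G = add_edge None (Some (n, w)) (fan_left_closed v u w n G)"
  by (simp add: fan_closed_def fan_left_closed_def)

lemma inj_on_fan_vertex: "inj_on (fan_vertex v i) A"
  by (auto simp: inj_on_def fan_vertex_def split: if_splits)

lemma edges_fan: "edges (fan v u w n G) = Inl ` ({1..n} \<times> edges G) \<union> Inr ` {1..<n}"
  by (simp add: fan_def add_edges_def identify_def copies_def)

lemma verts_fan: "verts (fan v u w n G) = (\<Union>i \<in> {1..n}. fan_vertex v i ` verts G)"
proof -
  have "verts (fan v u w n G) = merge_map ({1..n} \<times> {v}) ` ({1..n} \<times> verts G)"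
    by (simp add: fan_def add_edges_def identify_def copies_def)
  also have "\<dots> = (\<Union>i \<in> {1..n}. fan_vertex v i ` verts G)"
    by (force simp: merge_map_def fan_vertex_def)
  finally show ?thesis .
qed

lemma ends_fan:
  shows "i \<in> {1..n} \<Longrightarrow> ends (fan v u w n G) (Inl (i, e)) = map_uprod (fan_vertex v i) (ends G e)"
    and "ends (fan v u w n G) (Inr k) = Upair (Some (k, w)) (Some (k + 1, u))"
proof -
  assume "i \<in> {1..n}"
  then have "merge_map ({1..n} \<times> {v}) \<circ> Pair i = fan_vertex v i"
    by (auto simp: merge_map_def fan_vertex_def fun_eq_iff)
  then show "ends (fan v u w n G) (Inl (i, e)) = map_uprod (fan_vertex v i) (ends G e)"
    by (simp add: fan_def add_edges_def identify_def copies_def uprod.map_comp)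
qed (simp add: fan_def add_edges_def)

lemma linked_if_connected:
  "connected_multigraph G \<Longrightarrow> a \<in> verts G \<Longrightarrow> b \<in> verts G \<Longrightarrow> linked G (edges G) a b"
  by (auto simp: connected_multigraph_def reach_def)

lemma verts_fan_left_closed: "verts (fan_left_closed v u w n G) = verts (fan v u w n G)"
  by (simp add: fan_left_closed_def)

lemma edges_fan_left_closed: "edges (fan_left_closed v u w n G) =
    insert (Inr ()) (Inl ` (Inl ` ({1..n} \<times> edges G) \<union> Inr ` {1..<n}))"
  by (simp add: fan_left_closed_def edges_add_edge edges_fan)

lemma ends_fan_left_closed:
  shows "i \<in> {1..n} \<Longrightarrow> ends (fan_left_closed v u w n G) (Inl (Inl (i, e))) = map_uprod (fan_vertex v i) (ends G e)"
    and "ends (fan_left_closed v u w n G) (Inl (Inr k)) = Upair (Some (k, w)) (Some (k + 1, u))"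
    and "ends (fan_left_closed v u w n G) (Inr ()) = Upair None (Some (1, u))"
  by (simp_all add: fan_left_closed_def ends_fan)

lemma fan_left_closed_vertices_meet:
  "id ` verts (fan_left_closed v u w n G) \<inter> fan_vertex v (Suc n) ` verts G \<subseteq> {id None}"
  by (auto simp: verts_fan_left_closed verts_fan fan_vertex_def split: if_splits)

context
  fixes G :: "('v, 'e) multigraph" and v u w :: 'v
  assumes fin: "finite_multigraph G"
    and vs: "v \<in> verts G" "u \<in> verts G" "w \<in> verts G" and ne: "v \<noteq> u" "v \<noteq> w"
begin

lemma fan_vertices:
  assumes "n \<ge> 1"
  shows "None \<in> verts (fan v u w n G)"
    and "k \<in> {1..n} \<Longrightarrow> Some (k, u) \<in> verts (fan v u w n G)"
    and "k \<in> {1..n} \<Longrightarrow> Some (k, w) \<in> verts (fan v u w n G)"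
proof -
  have "fan_vertex v k a \<in> verts (fan v u w n G)" if "k \<in> {1..n}" "a \<in> verts G" for k a
    using that by (auto simp: verts_fan)
  from this[of 1 v] this[of k u] this[of k w] show
    "None \<in> verts (fan v u w n G)" "k \<in> {1..n} \<Longrightarrow> Some (k, u) \<in> verts (fan v u w n G)"
    "k \<in> {1..n} \<Longrightarrow> Some (k, w) \<in> verts (fan v u w n G)"
    using assms vs ne by (auto simp: fan_vertex_def)
qed

lemma finite_multigraph_fan:
  assumes "n \<ge> 1"
  shows "finite_multigraph (fan v u w n G)"
  unfolding finite_multigraph_def
proof (intro conjI ballI)
  show "finite (verts (fan v u w n G))" "finite (edges (fan v u w n G))"
    using fin by (auto simp: verts_fan edges_fan finite_multigraph_def)
  fix t assume "t \<in> edges (fan v u w n G)"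
  then consider i e where "t = Inl (i, e)" "i \<in> {1..n}" "e \<in> edges G" | k where "t = Inr k" "k \<in> {1..<n}"
    by (auto simp: edges_fan)
  then show "set_uprod (ends (fan v u w n G) t) \<subseteq> verts (fan v u w n G)"
  proof cases
    case 1
    obtain a b where "ends G e = Upair a b" "a \<in> verts G" "b \<in> verts G"
      using 1(3) by (rule finite_multigraph_ends[OF fin])
    with 1 show ?thesis by (auto simp: ends_fan verts_fan)
  next
    case 2
    then show ?thesis using fan_vertices[OF assms] by (simp add: ends_fan)
  qed
qed

lemma finite_multigraph_fan_left_closed: "n \<ge> 1 \<Longrightarrow> finite_multigraph (fan_left_closed v u w n G)"
  unfolding fan_left_closed_def
  by (intro finite_multigraph_add_edge finite_multigraph_fan fan_vertices) auto

lemma finite_multigraph_fan_closed: "n \<ge> 1 \<Longrightarrow> finite_multigraph (fan_closed v u w n G)"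
  unfolding fan_closed_eq
  by (intro finite_multigraph_add_edge finite_multigraph_fan_left_closed)
    (auto simp: fan_left_closed_def fan_vertices)

lemma linked_fan_left_closed:
  assumes conn: "connected_multigraph G" and n: "n \<ge> 1"
  shows "linked (fan_left_closed v u w n G) (edges (fan_left_closed v u w n G)) None (Some (n, w))"
proof -
  have "linked (fan_left_closed v u w n G) ((\<lambda>e. Inl (Inl (n, e))) ` edges G) (fan_vertex v n v) (fan_vertex v n w)
      \<longleftrightarrow> linked G (edges G) v w"
    by (rule linked_embedding[OF _ fin finite_multigraph_fan_left_closed[OF n] order_refl])
      (use n vs inj_on_fan_vertex in \<open>auto simp: ends_fan_left_closed\<close>)
  then have "linked (fan_left_closed v u w n G) ((\<lambda>e. Inl (Inl (n, e))) ` edges G) None (Some (n, w))"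
    using linked_if_connected[OF conn] vs ne by (simp add: fan_vertex_def)
  then show ?thesis
    by (rule linked_mono) (use n in \<open>auto simp: edges_fan_left_closed\<close>)
qed

text \<open>
  Gluing a further copy of \<open>G\<close> onto \<open>\<^sup>+G\<^sub>n\<close> gives \<open>\<^sup>+G\<^sub>n\<^sub>+\<^sub>1\<close>, and gluing a copy of \<open>G\<^sup>+\<close> gives
  \<open>\<^sup>+G\<^sub>n\<^sub>+\<^sub>1\<^sup>+\<close>. In both cases \<open>L = \<^sup>+G\<^sub>n\<close>, and \<open>L\<close> with the edge from \<open>v\<close> to the last copy of \<open>w\<close> is
  \<open>\<^sup>+G\<^sub>n\<^sup>+\<close>.
\<close>
lemma tutte_fan_left_closed_Suc:
  fixes x y :: "'a :: comm_ring_1"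
  assumes conn: "connected_multigraph G" and n: "n \<ge> 1"
  shows "tutte (fan_left_closed v u w (Suc n) G) x y = tutte (fan_closed v u w n G) x y * connected_sum G v u x y
    + x * (tutte (fan_left_closed v u w n G) x y * separated_sum G v u x y)"
  unfolding fan_closed_eq
proof (rule tutte_glue[where i = id and j = "fan_vertex v (Suc n)" and g = id
      and h = "\<lambda>e. Inl (Inl (Suc n, e))" and e = "Inl (Inr n)"])
  show "finite_multigraph (fan_left_closed v u w (Suc n) G)" "finite_multigraph (fan_left_closed v u w n G)"
    "finite_multigraph G" using n fin by (auto intro: finite_multigraph_fan_left_closed)
  show "None \<in> verts (fan_left_closed v u w n G)" "Some (n, w) \<in> verts (fan_left_closed v u w n G)"
    using n by (auto simp: verts_fan_left_closed fan_vertices)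
  show "inj_on (fan_vertex v (Suc n)) (verts G)" by (rule inj_on_fan_vertex)
  show "id None = fan_vertex v (Suc n) v" by (simp add: fan_vertex_def)
  show "edges (fan_left_closed v u w (Suc n) G) = insert (Inl (Inr n))
      (id ` edges (fan_left_closed v u w n G) \<union> (\<lambda>e. Inl (Inl (Suc n, e))) ` edges G)"
    using n by (auto simp: edges_fan_left_closed atLeastAtMostSuc_conv less_Suc_eq)
  show "ends (fan_left_closed v u w (Suc n) G) (id d) = map_uprod id (ends (fan_left_closed v u w n G) d)"
    if "d \<in> edges (fan_left_closed v u w n G)" for d
    using that by (auto simp: edges_fan_left_closed ends_fan_left_closed uprod.map_id)
  show "linked (fan_left_closed v u w n G) (edges (fan_left_closed v u w n G)) None (Some (n, w))"
    using conn n by (rule linked_fan_left_closed)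
  show "linked G (edges G) v u" using vs by (intro linked_if_connected[OF conn])
qed (use vs ne n fan_left_closed_vertices_meet[of v u w n G]
  in \<open>auto simp: edges_fan_left_closed ends_fan_left_closed fan_vertex_def inj_on_def\<close>)

lemma tutte_fan_closed_Suc:
  fixes x y :: "'a :: comm_ring_1"
  assumes conn: "connected_multigraph G" and n: "n \<ge> 1"
  shows "tutte (fan_closed v u w (Suc n) G) x y =
      tutte (fan_closed v u w n G) x y * connected_sum (add_edge v w G) v u x y
    + x * (tutte (fan_left_closed v u w n G) x y * separated_sum (add_edge v w G) v u x y)"
  unfolding fan_closed_eq[of v u w n]
proof (rule tutte_glue[where i = id and j = "fan_vertex v (Suc n)" and g = Inl
      and h = "case_sum (\<lambda>e. Inl (Inl (Inl (Suc n, e)))) Inr" and e = "Inl (Inl (Inr n))"])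
  show "finite_multigraph (fan_closed v u w (Suc n) G)" "finite_multigraph (fan_left_closed v u w n G)"
    "finite_multigraph (add_edge v w G)"
    using n fin vs
    by (auto intro: finite_multigraph_fan_left_closed finite_multigraph_fan_closed finite_multigraph_add_edge)
  show "None \<in> verts (fan_left_closed v u w n G)" "Some (n, w) \<in> verts (fan_left_closed v u w n G)"
    using n by (auto simp: verts_fan_left_closed fan_vertices)
  show "inj_on (fan_vertex v (Suc n)) (verts (add_edge v w G))"
    by (rule inj_on_fan_vertex)
  show "id None = fan_vertex v (Suc n) v" by (simp add: fan_vertex_def)
  show "edges (fan_closed v u w (Suc n) G) = insert (Inl (Inl (Inr n)))
      (Inl ` edges (fan_left_closed v u w n G) \<union>
       case_sum (\<lambda>e. Inl (Inl (Inl (Suc n, e)))) Inr ` edges (add_edge v w G))"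
    using n by (auto simp: fan_closed_eq edges_add_edge edges_fan_left_closed atLeastAtMostSuc_conv
        less_Suc_eq image_image)
  show "ends (fan_closed v u w (Suc n) G) (Inl d) = map_uprod id (ends (fan_left_closed v u w n G) d)"
    if "d \<in> edges (fan_left_closed v u w n G)" for d
    using that by (auto simp: fan_closed_eq edges_fan_left_closed ends_fan_left_closed uprod.map_id)
  show "ends (fan_closed v u w (Suc n) G) (case_sum (\<lambda>e. Inl (Inl (Inl (Suc n, e)))) Inr d) =
      map_uprod (fan_vertex v (Suc n)) (ends (add_edge v w G) d)"
    if "d \<in> edges (add_edge v w G)" for d
    using that ne by (auto simp: fan_closed_eq edges_add_edge ends_fan_left_closed fan_vertex_def)
  show "linked (fan_left_closed v u w n G) (edges (fan_left_closed v u w n G)) None (Some (n, w))"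
    using conn n by (rule linked_fan_left_closed)
  have "linked (add_edge v w G) (Inl ` edges G) v u" using vs by (simp add: linked_if_connected[OF conn])
  then show "linked (add_edge v w G) (edges (add_edge v w G)) v u"
    by (rule linked_mono) (simp add: edges_add_edge subset_insertI)
qed (use vs ne n fan_left_closed_vertices_meet[of v u w n G]
  in \<open>auto simp: edges_fan_left_closed edges_add_edge ends_fan_left_closed fan_vertex_def fan_closed_eq inj_on_def\<close>)

lemma tutte_fan_left_closed_1: "tutte (fan_left_closed v u w (Suc 0) G) x y = tutte (add_edge v u G) x y"
proof (rule tutte_iso[where i = "fan_vertex v 1" and g = "case_sum (\<lambda>e. Inl (Inl (1, e))) Inr"])
  show "bij_betw (case_sum (\<lambda>e. Inl (Inl (1, e))) Inr) (edges (add_edge v u G)) (edges (fan_left_closed v u w (Suc 0) G))"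
    by (auto simp: bij_betw_def inj_on_def edges_add_edge edges_fan_left_closed image_image image_Un)
  show "ends (fan_left_closed v u w (Suc 0) G) (case_sum (\<lambda>e. Inl (Inl (1, e))) Inr d) =
      map_uprod (fan_vertex v 1) (ends (add_edge v u G) d)" if "d \<in> edges (add_edge v u G)" for d
    using that ne by (auto simp: edges_add_edge ends_fan_left_closed fan_vertex_def)
qed (use fin vs inj_on_fan_vertex in \<open>auto intro: finite_multigraph_add_edge finite_multigraph_fan_left_closed\<close>)

lemma tutte_fan_closed_1:
  "tutte (fan_closed v u w (Suc 0) G) x y = tutte (add_edge v w (add_edge v u G)) x y"
proof (rule tutte_iso[where i = "fan_vertex v 1" and g = "map_sum (case_sum (\<lambda>e. Inl (Inl (1, e))) Inr) id"])
  show "bij_betw (map_sum (case_sum (\<lambda>e. Inl (Inl (1, e))) Inr) id)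
      (edges (add_edge v w (add_edge v u G))) (edges (fan_closed v u w (Suc 0) G))"
    by (auto simp: bij_betw_def inj_on_def edges_add_edge edges_fan_left_closed fan_closed_eq image_image image_Un)
  show "ends (fan_closed v u w (Suc 0) G) (map_sum (case_sum (\<lambda>e. Inl (Inl (1, e))) Inr) id d) =
      map_uprod (fan_vertex v 1) (ends (add_edge v w (add_edge v u G)) d)"
    if "d \<in> edges (add_edge v w (add_edge v u G))" for d
    using that ne by (auto simp: edges_add_edge ends_fan_left_closed fan_vertex_def fan_closed_eq)
qed (use fin vs inj_on_fan_vertex in \<open>auto intro: finite_multigraph_add_edge finite_multigraph_fan_closed\<close>)

end

section \<open>Second-order recurrences and Lucas polynomials\<close>

text \<open>
  The Lucas polynomials \<open>U\<^sub>n\<close> of the recurrence \<open>U\<^sub>n\<^sub>+\<^sub>2 = P U\<^sub>n\<^sub>+\<^sub>1 + Q U\<^sub>n\<close> with \<open>U\<^sub>0 = 0\<close> and \<open>U\<^sub>1 = 1\<close>.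
  The integer bound on \<open>j\<close> makes the sum for \<open>n = 0\<close> empty.
\<close>
definition lucas_sum :: "'a :: comm_ring_1 \<Rightarrow> 'a \<Rightarrow> nat \<Rightarrow> 'a" where
  "lucas_sum P Q n = (\<Sum>j | int j \<le> (int n - 1) div 2.
     of_nat ((n - j - 1) choose j) * P ^ (n - 2 * j - 1) * Q ^ j)"

lemma lucas_sum_0: "lucas_sum P Q 0 = 0"
  by (simp add: lucas_sum_def)

text \<open>Beyond the bound \<open>m div 2\<close> the binomial coefficients vanish, so the sum may run up to \<open>m\<close>.\<close>
lemma lucas_sum_Suc:
  "lucas_sum P Q (Suc m) = (\<Sum>j\<le>m. of_nat ((m - j) choose j) * P ^ (m - 2 * j) * Q ^ j)"
  unfolding lucas_sum_def
proof (rule sum.mono_neutral_cong_left)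
  show "\<forall>j \<in> {..m} - {j. int j \<le> (int (Suc m) - 1) div 2}.
      of_nat ((m - j) choose j) * P ^ (m - 2 * j) * Q ^ j = 0"
  proof
    fix j assume "j \<in> {..m} - {j. int j \<le> (int (Suc m) - 1) div 2}"
    then have "m - j < j" by auto
    then show "of_nat ((m - j) choose j) * P ^ (m - 2 * j) * Q ^ j = 0"
      by (simp add: binomial_eq_0)
  qed
qed auto

lemma lucas_sum_1: "lucas_sum P Q (Suc 0) = 1"
  by (simp add: lucas_sum_Suc)

text \<open>Pascal's rule splits each summand into one of \<open>P U\<^sub>n\<^sub>+\<^sub>1\<close> and one of \<open>Q U\<^sub>n\<close>.\<close>
lemma lucas_sum_rec: "lucas_sum P Q (Suc (Suc n)) = P * lucas_sum P Q (Suc n) + Q * lucas_sum P Q n"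
proof (cases n)
  case 0
  then show ?thesis by (simp add: lucas_sum_Suc lucas_sum_0)
next
  case (Suc m)
  let ?f = "\<lambda>j. of_nat ((m + 1 - j) choose j) * P ^ (m + 1 - 2 * j) * Q ^ j"
  let ?g = "\<lambda>j. of_nat ((m - j) choose j) * P ^ (m - 2 * j) * Q ^ j"
  let ?h = "\<lambda>j. of_nat ((m + 2 - j) choose j) * P ^ (m + 2 - 2 * j) * Q ^ j"
  have step: "?h (Suc j) = P * ?f (Suc j) + Q * ?g j" if "j \<le> m" for j
  proof -
    have "m + 2 - Suc j = Suc (m - j)" using that by simp
    then have 1: "(m + 2 - Suc j) choose Suc j = ((m - j) choose Suc j) + ((m - j) choose j)"
      by simp
    have 2: "m + 2 - 2 * Suc j = m - 2 * j" "m + 1 - Suc j = m - j" by simp_all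
    \<comment> \<open>where the exponent on the right is truncated, the binomial coefficient is zero\<close>
    have 3: "of_nat ((m - j) choose Suc j) * P ^ (m - 2 * j) = of_nat ((m - j) choose Suc j) * (P * P ^ (m + 1 - 2 * Suc j))"
    proof (cases "Suc j \<le> m - j")
      case True
      then have "m - 2 * j = Suc (m + 1 - 2 * Suc j)" by simp
      then show ?thesis by simp
    qed (simp add: binomial_eq_0)
    have "?h (Suc j) = of_nat ((m - j) choose Suc j) * P ^ (m - 2 * j) * Q ^ Suc j + Q * ?g j"
      unfolding 1 2 by (simp add: algebra_simps)
    then show ?thesis unfolding 2 3 by (simp add: algebra_simps)
  qed
  have "lucas_sum P Q (Suc (Suc n)) = (\<Sum>j\<le>Suc (Suc m). ?h j)"
    by (simp add: lucas_sum_Suc Suc)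
  also have "\<dots> = (\<Sum>j\<le>Suc m. ?h j)"
    by simp
  also have "\<dots> = ?h 0 + (\<Sum>j\<le>m. ?h (Suc j))"
    by (rule sum.atMost_Suc_shift)
  also have "\<dots> = P * ?f 0 + (\<Sum>j\<le>m. P * ?f (Suc j) + Q * ?g j)"
    using step by simp
  also have "\<dots> = P * (?f 0 + (\<Sum>j\<le>m. ?f (Suc j))) + Q * (\<Sum>j\<le>m. ?g j)"
    by (simp add: sum.distrib sum_distrib_left distrib_left)
  also have "?f 0 + (\<Sum>j\<le>m. ?f (Suc j)) = (\<Sum>j\<le>Suc m. ?f j)"
    by (rule sum.atMost_Suc_shift[symmetric])
  finally show ?thesis by (simp add: lucas_sum_Suc Suc)
qed

lemma lucas_sum_binet:
  fixes l1 l2 :: "'a :: field"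
  assumes "l1 \<noteq> l2"
  shows "lucas_sum (l1 + l2) (- (l1 * l2)) n = (l1 ^ n - l2 ^ n) / (l1 - l2)"
proof -
  have "(l1 - l2) * lucas_sum (l1 + l2) (- (l1 * l2)) n = l1 ^ n - l2 ^ n"
  proof (induction n rule: induct_nat_012)
    case (ge2 n)
    have "(l1 - l2) * lucas_sum (l1 + l2) (- (l1 * l2)) (Suc (Suc n)) =
        (l1 + l2) * (l1 ^ Suc n - l2 ^ Suc n) - l1 * l2 * (l1 ^ n - l2 ^ n)"
      unfolding lucas_sum_rec ge2[symmetric] by (simp add: algebra_simps)
    then show ?case by (simp add: algebra_simps)
  qed (simp_all add: lucas_sum_0 lucas_sum_1)
  then show ?thesis using assms by (simp add: nonzero_eq_divide_eq mult.commute)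
qed

text \<open>
  By Cayley-Hamilton \<open>t\<close> satisfies the recurrence of \<open>lucas_sum (A + D) (B * C - A * D)\<close>; the
  coefficients are read off from \<open>t 0\<close> and \<open>t 1 = C * s 0 + D * t 0\<close>.
\<close>
lemma linear_recurrence_closed_form:
  fixes s t :: "nat \<Rightarrow> 'a :: comm_ring_1"
  assumes "\<And>n. s (Suc n) = A * s n + B * t n" "\<And>n. t (Suc n) = C * s n + D * t n"
  shows "t n = (C * s 0 - A * t 0) * lucas_sum (A + D) (B * C - A * D) n
    + t 0 * lucas_sum (A + D) (B * C - A * D) (Suc n)"
proof (induction n rule: induct_nat_012)
  case 0 then show ?case by (simp add: lucas_sum_0 lucas_sum_1)
next
  case 1 then show ?case by (simp add: lucas_sum_rec lucas_sum_0 lucas_sum_1 assms algebra_simps)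
next
  case (ge2 n)
  have "t (Suc (Suc n)) = (A + D) * t (Suc n) + (B * C - A * D) * t n"
    by (simp add: assms algebra_simps)
  then show ?case unfolding ge2 by (simp only: lucas_sum_rec) (simp add: algebra_simps)
qed

section \<open>The discriminant does not vanish\<close>

lemma
  fixes x y :: "'a :: comm_ring_1" and h :: "'a \<Rightarrow> 'b :: comm_ring_1"
  assumes h: "\<And>p q. h (p + q) = h p + h q" "\<And>p q. h (p * q) = h p * h q" "h 1 = 1"
  shows connected_sum_hom: "h (connected_sum G a b x y) = connected_sum G a b (h x) (h y)"
    and separated_sum_hom: "h (separated_sum G a b x y) = separated_sum G a b (h x) (h y)"
proof -
  have h0: "h 0 = 0" using h(1)[of 0 0] by simp
  have hm: "h (p - q) = h p - h q" for p q using h(1)[of "p - q" q] by (simp add: algebra_simps)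
  have hs: "h (sum f S) = (\<Sum>i\<in>S. h (f i))" for f and S :: "'z set"
    by (induction S rule: infinite_finite_induct) (simp_all add: h h0)
  have hp: "h (p ^ k) = h p ^ k" for p k by (induction k) (simp_all add: h)
  show "h (connected_sum G a b x y) = connected_sum G a b (h x) (h y)"
    "h (separated_sum G a b x y) = separated_sum G a b (h x) (h y)"
    unfolding connected_sum_def separated_sum_def hs by (intro sum.cong refl; simp add: h h0 hp hm)+
qed

text \<open>
  At \<open>x = y = 2\<close> both sums count edge sets. The full edge set is among the connecting ones, the empty
  one among the others.
\<close>
lemma connected_sum_pos:
  assumes "finite_multigraph G" "linked G (edges G) a b"
  shows "connected_sum G a b 2 (2 :: 'a :: linordered_idom) > 0"
  unfolding connected_sum_def using assms
  by (intro sum_pos2[of _ "edges G"]) (auto simp: finite_multigraph_def)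

lemma separated_sum_pos:
  assumes "finite_multigraph G" "a \<noteq> b"
  shows "separated_sum G a b 2 (2 :: 'a :: linordered_idom) > 0"
  unfolding separated_sum_def using assms
  by (intro sum_pos2[of _ "{}"]) (auto simp: finite_multigraph_def adjacency_def)

text \<open>
  The expression is the image of a polynomial whose value at \<open>x = y = 2\<close> is a square plus a
  positive number.
\<close>
lemma discriminant_nonzero:
  fixes G :: "('v, 'e) multigraph" and K :: "('w, 'f) multigraph"
  assumes G: "finite_multigraph G" "linked G (edges G) a b" 
    and K: "finite_multigraph K" "a' \<noteq> b'"
  shows "(var_x * separated_sum G a b var_x var_y - connected_sum K a' b' var_x var_y)\<^sup>2
    + 4 * connected_sum G a b var_x var_y * (var_x * separated_sum K a' b' var_x var_y) \<noteq> 0"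
proof -
  let ?h = "\<lambda>p :: rat poly poly. to_ac (to_fract p)"
  let ?ev = "\<lambda>p :: rat poly poly. poly (poly p [:2:]) 2"
  let ?X = "[:[:0, 1:]:] :: rat poly poly" and ?Y = "[:0, 1:] :: rat poly poly"
  define d where "d = (?X * separated_sum G a b ?X ?Y - connected_sum K a' b' ?X ?Y)\<^sup>2
    + 4 * connected_sum G a b ?X ?Y * (?X * separated_sum K a' b' ?X ?Y)"
  have "?ev d = (2 * separated_sum G a b 2 2 - connected_sum K a' b' 2 2)\<^sup>2
    + 4 * connected_sum G a b 2 2 * (2 * separated_sum K a' b' 2 2)"
    by (simp add: d_def connected_sum_hom[where h = ?ev] separated_sum_hom[where h = ?ev])
  also have "\<dots> > 0"
    using connected_sum_pos[OF G, where 'a = rat] separated_sum_pos[OF K, where 'a = rat]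
    by (intro add_nonneg_pos mult_pos_pos) auto
  finally have "d \<noteq> 0" by auto
  then have "?h d \<noteq> 0" by simp
  moreover have "?h (1 + 1 + 1 + 1) = 1 + 1 + 1 + 1"
    by (simp only: to_fract_add to_fract_1 to_ac_add to_ac_1)
  then have h4: "?h 4 = 4" by simp
  have hc: "?h (connected_sum G a b ?X ?Y) = connected_sum G a b var_x var_y"
      "?h (connected_sum K a' b' ?X ?Y) = connected_sum K a' b' var_x var_y"
    unfolding var_x_def var_y_def by (rule connected_sum_hom[where h = ?h]; simp)+
  have hs: "?h (separated_sum G a b ?X ?Y) = separated_sum G a b var_x var_y"
      "?h (separated_sum K a' b' ?X ?Y) = separated_sum K a' b' var_x var_y"
    unfolding var_x_def var_y_def by (rule separated_sum_hom[where h = ?h]; simp)+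
  have "?h d = (var_x * separated_sum G a b var_x var_y - connected_sum K a' b' var_x var_y)\<^sup>2
    + 4 * connected_sum G a b var_x var_y * (var_x * separated_sum K a' b' var_x var_y)"
    unfolding d_def power2_eq_square
    by (simp only: to_fract_add to_fract_mult to_fract_diff to_ac_add to_ac_mult to_ac_diff hc hs h4
        var_x_def[symmetric])
  ultimately show ?thesis by simp
qed

lemma xy_nonzero: "var_x * var_y - var_x - var_y \<noteq> 0"
proof -
  have "var_x * var_y - var_x - var_y = to_ac (to_fract ([:[:0, 1:]:] * [:0, 1:] - [:[:0, 1:]:] - [:0, 1:] :: rat poly poly))"
    by (simp only: var_x_def var_y_def to_ac_mult to_ac_diff to_fract_mult to_fract_diff)
  also have "\<dots> \<noteq> 0" by simp
  finally show ?thesis .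
qed

lemma two_nonzero: "(2 :: ratfun_closure) \<noteq> 0"
proof -
  have "(2 :: ratfun_closure) = to_ac (to_fract (1 + 1))"
    unfolding to_fract_add to_ac_add by simp
  then show ?thesis by simp
qed

section \<open>The Tutte polynomial of the closed fan\<close>

theorem theorem3p7:
  fixes G :: "('v, 'e) multigraph" and v u w :: 'v and n :: nat
    and x y A B C D \<delta> lam\<^sub>1 lam\<^sub>2 :: ratfun_closure
  assumes "finite_multigraph G" and "connected_multigraph G"
    and "v \<in> verts G" and "u \<in> verts G" and "w \<in> verts G"
    and "v \<noteq> u" and "v \<noteq> w" and "u \<noteq> w"
    and "n \<ge> 1"
    and "x = var_x" and "y = var_y"
    and "A = x / (x * y - x - y) *
      ((y - 1) * tutte_poly G - tutte_poly (identify {v, u} G))"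
    and "B = 1 / (x * y - x - y) *
      ((x - 1) * tutte_poly (identify {v, u} G) - tutte_poly G)"
    and "C = x / (x * y - x - y) *
      ((y - 1) * tutte_poly (add_edge v w G) - tutte_poly (identify {v, u} (add_edge v w G)))"
    and "D = 1 / (x * y - x - y) *
      ((x - 1) * tutte_poly (identify {v, u} (add_edge v w G)) - tutte_poly (add_edge v w G))"
    and "\<delta>\<^sup>2 = (A - D)\<^sup>2 + 4 * B * C"
    and "lam\<^sub>1 = (A + D + \<delta>) / 2" and "lam\<^sub>2 = (A + D - \<delta>) / 2"
  shows "(tutte_poly (fan_closed v u w n G) =
      tutte_poly (add_edge v w (add_edge v u G)) * ((lam\<^sub>1 ^ n - lam\<^sub>2 ^ n) / (lam\<^sub>1 - lam\<^sub>2)) +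
      (C * tutte_poly (add_edge v u G) - A * tutte_poly (add_edge v w (add_edge v u G))) *
        ((lam\<^sub>1 ^ (n - 1) - lam\<^sub>2 ^ (n - 1)) / (lam\<^sub>1 - lam\<^sub>2))) \<and>
    (tutte_poly (fan_closed v u w n G) =
      (C * tutte_poly (add_edge v u G) - A * tutte_poly (add_edge v w (add_edge v u G))) *
        (\<Sum>j | int j \<le> (int n - 2) div 2.
          of_nat ((n - j - 2) choose j) * (A + D) ^ (n - 2 * j - 2) * (B * C - A * D) ^ j) +
      tutte_poly (add_edge v w (add_edge v u G)) *
        (\<Sum>j | int j \<le> (int n - 1) div 2.
          of_nat ((n - j - 1) choose j) * (A + D) ^ (n - 2 * j - 1) * (B * C - A * D) ^ j))"
proof -
  have li: "linked G (edges G) v u"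
    by (rule linked_if_connected[OF assms(2-4)])
  let ?K = "add_edge v w G" and ?r = "x * y - x - y"
  have finK: "finite_multigraph ?K"
    using assms by (intro finite_multigraph_add_edge)
  have "linked ?K (Inl ` edges G) v u" using li by simp
  then have liK: "linked ?K (edges ?K) v u"
    by (rule linked_mono) (simp add: edges_add_edge subset_insertI)
  have vK: "v \<in> verts ?K" "u \<in> verts ?K" using assms by simp_all
  have r: "?r \<noteq> 0" using xy_nonzero assms(10,11) by simp
  \<comment> \<open>inverting the linear system \<open>T = c + (x - 1) s\<close>, \<open>T' = (y - 1) c + s\<close>, whose determinant is
    \<open>- (x y - x - y)\<close>\<close>
  have solve: "x / ?r * ((y - 1) * (c + (x - 1) * s) - ((y - 1) * c + s)) = x * s"
    "1 / ?r * ((x - 1) * ((y - 1) * c + s) - (c + (x - 1) * s)) = c" for c s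
  proof -
    have "(y - 1) * (c + (x - 1) * s) - ((y - 1) * c + s) = ?r * s"
      "(x - 1) * ((y - 1) * c + s) - (c + (x - 1) * s) = ?r * c" by (simp_all add: algebra_simps)
    then show "x / ?r * ((y - 1) * (c + (x - 1) * s) - ((y - 1) * c + s)) = x * s"
      "1 / ?r * ((x - 1) * ((y - 1) * c + s) - (c + (x - 1) * s)) = c" using r by simp_all
  qed
  have A: "A = x * separated_sum G v u x y" and B: "B = connected_sum G v u x y"
    unfolding assms(12,13) tutte_poly_def assms(10,11)[symmetric]
      tutte_eq_sums[OF assms(1,3,4) li] tutte_identify[OF assms(1,3,4) li assms(6)]
    by (rule solve)+
  have C: "C = x * separated_sum ?K v u x y" and D: "D = connected_sum ?K v u x y"
    unfolding assms(14,15) tutte_poly_def assms(10,11)[symmetric]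
      tutte_eq_sums[OF finK vK liK] tutte_identify[OF finK vK liK assms(6)]
    by (rule solve)+
  \<comment> \<open>indices are shifted by one since fans start with one copy\<close>
  define s where "s k = tutte (fan_left_closed v u w (Suc k) G) x y" for k
  define t where "t k = tutte (fan_closed v u w (Suc k) G) x y" for k
  have rec: "s (Suc k) = A * s k + B * t k" "t (Suc k) = C * s k + D * t k" for k
    unfolding s_def t_def
    by (simp_all add: A B C D tutte_fan_left_closed_Suc[OF assms(1,3-7,2)] tutte_fan_closed_Suc[OF assms(1,3-7,2)]
        algebra_simps)
  have s0: "s 0 = tutte_poly (add_edge v u G)" and t0: "t 0 = tutte_poly (add_edge v w (add_edge v u G))"
    unfolding s_def t_def tutte_poly_def assms(10,11)[symmetric]
    by (rule tutte_fan_left_closed_1[OF assms(1,3-7)] tutte_fan_closed_1[OF assms(1,3-7)])+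
  let ?U = "lucas_sum (A + D) (B * C - A * D)"
  have "tutte_poly (fan_closed v u w n G) = t (n - 1)"
    using assms(9) by (simp add: t_def tutte_poly_def assms(10,11))
  then have main: "tutte_poly (fan_closed v u w n G) =
      (C * s 0 - A * t 0) * ?U (n - 1) + t 0 * ?U n"
    using linear_recurrence_closed_form[of s A B t C D "n - 1"] rec assms(9) by simp
  have two: "(2 :: ratfun_closure) \<noteq> 0" by (rule two_nonzero)
  have "\<delta>\<^sup>2 \<noteq> 0"
    unfolding assms(16) A B C D unfolding assms(10,11)
    using assms(6) by (intro discriminant_nonzero assms(1) li finK[unfolded assms(10,11)])
  then have "\<delta> \<noteq> 0" by auto
  have l: "2 * lam\<^sub>1 = A + D + \<delta>" "2 * lam\<^sub>2 = A + D - \<delta>"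
    using two by (simp_all add: assms(17,18))
  have "2 * (lam\<^sub>1 - lam\<^sub>2) = 2 * \<delta>" "2 * (lam\<^sub>1 + lam\<^sub>2) = 2 * (A + D)"
    using l by (simp_all add: algebra_simps)
  then have diff: "lam\<^sub>1 - lam\<^sub>2 = \<delta>" and sum: "lam\<^sub>1 + lam\<^sub>2 = A + D"
    using two by (metis mult_left_cancel)+
  have "2 * 2 * (lam\<^sub>1 * lam\<^sub>2) = (2 * lam\<^sub>1) * (2 * lam\<^sub>2)" by (simp only: ac_simps)
  also have "\<dots> = (A + D)\<^sup>2 - \<delta>\<^sup>2" unfolding l by (simp add: algebra_simps power2_eq_square)
  also have "\<dots> = 2 * 2 * (A * D - B * C)"
    unfolding assms(16) by (simp add: algebra_simps power2_eq_square)
  finally have "2 * 2 * (lam\<^sub>1 * lam\<^sub>2) = 2 * 2 * (A * D - B * C)" .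
  moreover have "(2 * 2 :: ratfun_closure) \<noteq> 0" using two by (metis no_zero_divisors)
  ultimately have "lam\<^sub>1 * lam\<^sub>2 = A * D - B * C" using mult_left_cancel by blast
  then have "- (lam\<^sub>1 * lam\<^sub>2) = B * C - A * D" by simp
  moreover have "lam\<^sub>1 \<noteq> lam\<^sub>2" using diff \<open>\<delta> \<noteq> 0\<close> by auto
  ultimately have binet: "?U k = (lam\<^sub>1 ^ k - lam\<^sub>2 ^ k) / (lam\<^sub>1 - lam\<^sub>2)" for k
    using lucas_sum_binet[of "lam\<^sub>1" "lam\<^sub>2" k] sum by simp
  have "?U (n - 1) = (\<Sum>j | int j \<le> (int n - 2) div 2.
      of_nat ((n - j - 2) choose j) * (A + D) ^ (n - 2 * j - 2) * (B * C - A * D) ^ j)"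
  proof -
    have "int (n - 1) - 1 = int n - 2" "n - 1 - j - 1 = n - j - 2" "n - 1 - 2 * j - 1 = n - 2 * j - 2" for j
      using assms(9) by auto
    then show ?thesis unfolding lucas_sum_def by simp
  qed
  then show ?thesis
    using main binet[of n] binet[of "n - 1"] unfolding s0 t0
    by (simp add: lucas_sum_def[of _ _ n] add.commute)
qed

end
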